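(* Let $A$ be a Keigher ring, $X=\operatorname{Spec}^\Delta A$, and let $D$ be a differential subring of $\mathcal O(X)$ containing $\iota(A)$. Let $\iota\colon A\to D$ denote the corresponding homomorphism. Then $\iota^*\colon\operatorname{Spec}^\Delta D\to\operatorname{Spec}^\Delta A$, $\mathfrak q\mapsto\iota^{-1}(\mathfrak q)$, is a homeomorphism.
   Context: All rings are commutative with unit. A differential ring is a ring with finitely many pairwise commuting derivations. A Keigher ring is a differential ring in which the radical $\{x: x^n\in\mathfrak a\text{ for some }n\}$ of every differential ideal $\mathfrak a$ is again a differential ideal. $\operatorname{Spec}^\Delta R$ is the set of prime ideals of a differential ring $R$ closed under all derivations, with the Kolchin topology (closed sets $V(E)=\{\mathfrak p: E\subseteq\mathfrak p\}$). For $\mathfrak p\in X$, $A_{\mathfrak p}$ is the localization at $A\setminus\mathfrak p$. Structure sheaf: for open $U\subseteq X$, $\mathcal O(U)$ is the set of functions $f$ on $U$ with $f(\mathfrak p)\in A_{\mathfrak p}$ that are regular at every point of $U$, where $f$ is regular at $\mathfrak p$ if there exist an open neighborhood $W\subseteq U$ of $\mathfrak p$ and $a,b\in A$ with $b\notin\mathfrak q$ and $f(\mathfrak q)=a/b$ in $A_{\mathfrak q}$ for all $\mathfrak q\in W$; it is a differential ring with pointwise operations and derivations. The differential homomorphism $\iota\colon A\to\mathcal O(X)$ sends $a$ to the function $\mathfrak p\mapsto a/1\in A_{\mathfrak p}$. *)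

theory Defs
  imports "HOL-Algebra.Subrings" "HOL-Algebra.Ideal" "HOL-Analysis.Abstract_Topology"
begin

definition derivation :: "('a, 'm) ring_scheme \<Rightarrow> ('a \<Rightarrow> 'a) \<Rightarrow> bool" where
  "derivation R d \<longleftrightarrow>
     (\<forall>x\<in>carrier R. d x \<in> carrier R) \<and>
     (\<forall>x\<in>carrier R. \<forall>y\<in>carrier R. d (x \<oplus>\<^bsub>R\<^esub> y) = d x \<oplus>\<^bsub>R\<^esub> d y) \<and>
     (\<forall>x\<in>carrier R. \<forall>y\<in>carrier R.
        d (x \<otimes>\<^bsub>R\<^esub> y) = (d x \<otimes>\<^bsub>R\<^esub> y) \<oplus>\<^bsub>R\<^esub> (x \<otimes>\<^bsub>R\<^esub> d y))"

definition diff_ring :: "('a, 'm) ring_scheme \<Rightarrow> ('a \<Rightarrow> 'a) set \<Rightarrow> bool" where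
  "diff_ring R \<Delta> \<longleftrightarrow> cring R \<and> finite \<Delta> \<and> (\<forall>d\<in>\<Delta>. derivation R d) \<and>
     (\<forall>d\<in>\<Delta>. \<forall>e\<in>\<Delta>. \<forall>x\<in>carrier R. d (e x) = e (d x))"

definition diff_ideal :: "('a, 'm) ring_scheme \<Rightarrow> ('a \<Rightarrow> 'a) set \<Rightarrow> 'a set \<Rightarrow> bool" where
  "diff_ideal R \<Delta> I \<longleftrightarrow> ideal I R \<and> (\<forall>d\<in>\<Delta>. \<forall>x\<in>I. d x \<in> I)"

definition ring_radical :: "('a, 'm) ring_scheme \<Rightarrow> 'a set \<Rightarrow> 'a set" where
  "ring_radical R I = {x \<in> carrier R. \<exists>n::nat. x [^]\<^bsub>R\<^esub> n \<in> I}"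

definition keigher_ring :: "('a, 'm) ring_scheme \<Rightarrow> ('a \<Rightarrow> 'a) set \<Rightarrow> bool" where
  "keigher_ring R \<Delta> \<longleftrightarrow> diff_ring R \<Delta> \<and>
     (\<forall>I. diff_ideal R \<Delta> I \<longrightarrow> diff_ideal R \<Delta> (ring_radical R I))"

definition dspec :: "('a, 'm) ring_scheme \<Rightarrow> ('a \<Rightarrow> 'a) set \<Rightarrow> 'a set set" where
  "dspec R \<Delta> = {p. primeideal p R \<and> (\<forall>d\<in>\<Delta>. \<forall>x\<in>p. d x \<in> p)}"

definition kolchin_V :: "('a, 'm) ring_scheme \<Rightarrow> ('a \<Rightarrow> 'a) set \<Rightarrow> 'a set \<Rightarrow> 'a set set" where
  "kolchin_V R \<Delta> E = {p \<in> dspec R \<Delta>. E \<subseteq> p}"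

definition kolchin_open :: "('a, 'm) ring_scheme \<Rightarrow> ('a \<Rightarrow> 'a) set \<Rightarrow> 'a set set \<Rightarrow> bool" where
  "kolchin_open R \<Delta> W \<longleftrightarrow> (\<exists>E. W = dspec R \<Delta> - kolchin_V R \<Delta> E)"

definition kolchin_topology :: "('a, 'm) ring_scheme \<Rightarrow> ('a \<Rightarrow> 'a) set \<Rightarrow> 'a set topology" where
  "kolchin_topology R \<Delta> = topology (kolchin_open R \<Delta>)"

definition loc_frac :: "('a, 'm) ring_scheme \<Rightarrow> 'a set \<Rightarrow> 'a \<Rightarrow> 'a \<Rightarrow> ('a \<times> 'a) set" where
  "loc_frac R p a s = {(b, t). b \<in> carrier R \<and> t \<in> carrier R - p \<and>
      (\<exists>u\<in>carrier R - p. u \<otimes>\<^bsub>R\<^esub> ((a \<otimes>\<^bsub>R\<^esub> t) \<ominus>\<^bsub>R\<^esub> (b \<otimes>\<^bsub>R\<^esub> s)) = \<zero>\<^bsub>R\<^esub>)}"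

definition loc_elems :: "('a, 'm) ring_scheme \<Rightarrow> 'a set \<Rightarrow> ('a \<times> 'a) set set" where
  "loc_elems R p = {loc_frac R p a s | a s. a \<in> carrier R \<and> s \<in> carrier R - p}"

definition loc_rep :: "('a \<times> 'a) set \<Rightarrow> 'a \<times> 'a" where
  "loc_rep x = (SOME r. r \<in> x)"

definition loc_add :: "('a, 'm) ring_scheme \<Rightarrow> 'a set \<Rightarrow> ('a \<times> 'a) set \<Rightarrow> ('a \<times> 'a) set \<Rightarrow> ('a \<times> 'a) set" where
  "loc_add R p x y = (let (a, s) = loc_rep x; (b, t) = loc_rep y in
     loc_frac R p ((a \<otimes>\<^bsub>R\<^esub> t) \<oplus>\<^bsub>R\<^esub> (b \<otimes>\<^bsub>R\<^esub> s)) (s \<otimes>\<^bsub>R\<^esub> t))"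

definition loc_mult :: "('a, 'm) ring_scheme \<Rightarrow> 'a set \<Rightarrow> ('a \<times> 'a) set \<Rightarrow> ('a \<times> 'a) set \<Rightarrow> ('a \<times> 'a) set" where
  "loc_mult R p x y = (let (a, s) = loc_rep x; (b, t) = loc_rep y in
     loc_frac R p (a \<otimes>\<^bsub>R\<^esub> b) (s \<otimes>\<^bsub>R\<^esub> t))"

definition loc_der :: "('a, 'm) ring_scheme \<Rightarrow> 'a set \<Rightarrow> ('a \<Rightarrow> 'a) \<Rightarrow> ('a \<times> 'a) set \<Rightarrow> ('a \<times> 'a) set" where
  "loc_der R p d x = (let (a, s) = loc_rep x in
     loc_frac R p ((d a \<otimes>\<^bsub>R\<^esub> s) \<ominus>\<^bsub>R\<^esub> (a \<otimes>\<^bsub>R\<^esub> d s)) (s \<otimes>\<^bsub>R\<^esub> s))"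

text \<open>A section is a function on all sets of elements; it is required to take values in
  A_p at points p of X and to be {} (a dummy value) outside X.\<close>

definition regular_at :: "('a, 'm) ring_scheme \<Rightarrow> ('a \<Rightarrow> 'a) set \<Rightarrow> ('a set \<Rightarrow> ('a \<times> 'a) set) \<Rightarrow> 'a set \<Rightarrow> bool" where
  "regular_at R \<Delta> f p \<longleftrightarrow> (\<exists>W. kolchin_open R \<Delta> W \<and> p \<in> W \<and>
     (\<exists>a\<in>carrier R. \<exists>b\<in>carrier R. \<forall>q\<in>W. b \<notin> q \<and> f q = loc_frac R q a b))"

definition sections :: "('a, 'm) ring_scheme \<Rightarrow> ('a \<Rightarrow> 'a) set \<Rightarrow> ('a set \<Rightarrow> ('a \<times> 'a) set) set" where
  "sections R \<Delta> = {f. (\<forall>p\<in>dspec R \<Delta>. f p \<in> loc_elems R p \<and> regular_at R \<Delta> f p) \<and>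
                        (\<forall>p. p \<notin> dspec R \<Delta> \<longrightarrow> f p = {})}"

definition loc_iota :: "('a, 'm) ring_scheme \<Rightarrow> ('a \<Rightarrow> 'a) set \<Rightarrow> 'a \<Rightarrow> ('a set \<Rightarrow> ('a \<times> 'a) set)" where
  "loc_iota R \<Delta> a = (\<lambda>p. if p \<in> dspec R \<Delta> then loc_frac R p a \<one>\<^bsub>R\<^esub> else {})"

definition sections_ring :: "('a, 'm) ring_scheme \<Rightarrow> ('a \<Rightarrow> 'a) set \<Rightarrow> ('a set \<Rightarrow> ('a \<times> 'a) set) ring" where
  "sections_ring R \<Delta> =
    \<lparr>carrier = sections R \<Delta>,
     mult = (\<lambda>f g p. if p \<in> dspec R \<Delta> then loc_mult R p (f p) (g p) else {}),
     one = loc_iota R \<Delta> \<one>\<^bsub>R\<^esub>,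
     zero = loc_iota R \<Delta> \<zero>\<^bsub>R\<^esub>,
     add = (\<lambda>f g p. if p \<in> dspec R \<Delta> then loc_add R p (f p) (g p) else {})\<rparr>"

definition sec_der :: "('a, 'm) ring_scheme \<Rightarrow> ('a \<Rightarrow> 'a) set \<Rightarrow> ('a \<Rightarrow> 'a)
    \<Rightarrow> ('a set \<Rightarrow> ('a \<times> 'a) set) \<Rightarrow> ('a set \<Rightarrow> ('a \<times> 'a) set)" where
  "sec_der R \<Delta> d f = (\<lambda>p. if p \<in> dspec R \<Delta> then loc_der R p d (f p) else {})"

end

theory Submission
  imports Defs
begin

text \<open>For a differential prime \<open>p\<close> of the base ring, the sections in \<open>D\<close> whose value at \<open>p\<close> lies in
  the maximal ideal of the localization form a differential prime \<open>vanish p\<close> of \<open>D\<close> that contracts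
  to \<open>p\<close>. It is the only one. Let \<open>q\<close> contract to \<open>p\<close>, let \<open>f \<in> D\<close>, and write \<open>f = a / b\<close> on a basic
  open set \<open>D(h)\<close> around \<open>p\<close>. The section \<open>e = h (b f - a)\<close> has all its values in the maximal ideals;
  since in a Keigher ring an element of all differential primes is nilpotent, \<open>e\<close> is locally
  nilpotent, hence nilpotent, hence \<open>e \<in> q\<close>. As \<open>h, b \<notin> p\<close>, this gives \<open>f \<in> q\<close> iff \<open>a \<in> p\<close>.
  The inverse bijection \<open>vanish\<close> is continuous because \<open>f\<close> is locally a fraction.\<close>

section \<open>Ideals and derivations of commutative rings\<close>

lemma (in cring) ideal_if_mult_closed:
  assumes "I \<subseteq> carrier R" "\<zero> \<in> I"
    and add: "\<And>x y. \<lbrakk>x \<in> I; y \<in> I\<rbrakk> \<Longrightarrow> x \<oplus> y \<in> I"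
    and mult: "\<And>r x. \<lbrakk>r \<in> carrier R; x \<in> I\<rbrakk> \<Longrightarrow> r \<otimes> x \<in> I"
  shows "ideal I R"
proof (rule idealI)
  show "ring R" ..
  show "subgroup I (add_monoid R)"
  proof
    fix x assume "x \<in> I"
    \<comment> \<open>Multiplication by -1 supplies the additive inverses, so closure under negation
      need not be assumed separately.\<close>
    moreover have "(\<ominus> \<one>) \<otimes> x = \<ominus> x"
      using \<open>x \<in> I\<close> assms(1) by (auto simp: l_minus)
    ultimately show "inv\<^bsub>add_monoid R\<^esub> x \<in> I"
      using mult[of "\<ominus> \<one>" x] by (simp add: a_inv_def)
  qed (use assms in auto)
next
  fix a x assume ax: "a \<in> I" "x \<in> carrier R"
  then show "x \<otimes> a \<in> I"
    by (intro mult)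
  with ax assms(1) show "a \<otimes> x \<in> I"
    by (simp add: m_comm subset_iff)
qed

lemma (in ideal) mem_iff_if_minus_mem:
  assumes c: "x \<in> carrier R" "y \<in> carrier R" and mem: "x \<ominus> y \<in> I"
  shows "x \<in> I \<longleftrightarrow> y \<in> I"
proof
  have "x \<oplus> \<ominus> (x \<ominus> y) = y"
    using c by algebra
  then show "y \<in> I" if "x \<in> I"
    using additive_subgroup.a_closed[OF is_additive_subgroup that
        additive_subgroup.a_inv_closed[OF is_additive_subgroup mem]] by simp
  have "(x \<ominus> y) \<oplus> y = x"
    using c by algebra
  then show "x \<in> I" if "y \<in> I"
    using additive_subgroup.a_closed[OF is_additive_subgroup mem that] by simp
qed

locale diff_cring = cring R for R (structure) +
  fixes \<Delta> :: "('a \<Rightarrow> 'a) set"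
  assumes derivation: "d \<in> \<Delta> \<Longrightarrow> derivation R d"
begin

lemma der_closed [simp, intro]: "\<lbrakk>d \<in> \<Delta>; x \<in> carrier R\<rbrakk> \<Longrightarrow> d x \<in> carrier R"
  using derivation by (simp add: derivation_def)

lemma der_add: "\<lbrakk>d \<in> \<Delta>; x \<in> carrier R; y \<in> carrier R\<rbrakk> \<Longrightarrow> d (x \<oplus> y) = d x \<oplus> d y"
  using derivation by (simp add: derivation_def)

lemma der_mult:
  "\<lbrakk>d \<in> \<Delta>; x \<in> carrier R; y \<in> carrier R\<rbrakk> \<Longrightarrow> d (x \<otimes> y) = d x \<otimes> y \<oplus> x \<otimes> d y"
  using derivation by (simp add: derivation_def)

lemma der_zero: "d \<in> \<Delta> \<Longrightarrow> d \<zero> = \<zero>"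
  using der_add[of d \<zero> \<zero>] by (simp add: add.l_cancel_one)

lemma der_one: "d \<in> \<Delta> \<Longrightarrow> d \<one> = \<zero>"
  using der_mult[of d \<one> \<one>] by (simp add: add.l_cancel_one)

lemma der_minus:
  assumes "d \<in> \<Delta>" "x \<in> carrier R" "y \<in> carrier R"
  shows "d (x \<ominus> y) = d x \<ominus> d y"
proof -
  have "d y \<oplus> d (\<ominus> y) = \<zero>"
    using der_add[of d y "\<ominus> y"] der_zero[of d] assms by (simp add: r_neg)
  then have "d (\<ominus> y) = \<ominus> d y"
    using minus_equality[of "d (\<ominus> y)" "d y"] assms by (simp add: a_comm)
  then show ?thesis
    using der_add[of d x "\<ominus> y"] assms by (simp add: minus_eq)
qed

end

subsection \<open>Semiprime differential ideals\<close>

text \<open>These are the radical differential ideals: closure under square roots gives closure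
  under roots of every order, by enlarging the exponent to a power of two. The exponent two is the
  form that the colon and Zorn arguments produce.\<close>

definition semiprime_diff_ideal :: "('a, 'm) ring_scheme \<Rightarrow> ('a \<Rightarrow> 'a) set \<Rightarrow> 'a set \<Rightarrow> bool" where
  "semiprime_diff_ideal R \<Delta> I \<longleftrightarrow>
     diff_ideal R \<Delta> I \<and> (\<forall>x\<in>carrier R. x \<otimes>\<^bsub>R\<^esub> x \<in> I \<longrightarrow> x \<in> I)"

lemma semiprime_diff_idealD:
  assumes "semiprime_diff_ideal R \<Delta> I"
  shows "ideal I R" "\<lbrakk>d \<in> \<Delta>; x \<in> I\<rbrakk> \<Longrightarrow> d x \<in> I"
    "\<lbrakk>x \<in> carrier R; x \<otimes>\<^bsub>R\<^esub> x \<in> I\<rbrakk> \<Longrightarrow> x \<in> I"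
  using assms by (auto simp: semiprime_diff_ideal_def diff_ideal_def)

context diff_cring
begin

lemma semiprime_diff_idealI:
  assumes "I \<subseteq> carrier R" "\<zero> \<in> I"
    and "\<And>x y. \<lbrakk>x \<in> I; y \<in> I\<rbrakk> \<Longrightarrow> x \<oplus> y \<in> I"
    and "\<And>r x. \<lbrakk>r \<in> carrier R; x \<in> I\<rbrakk> \<Longrightarrow> r \<otimes> x \<in> I"
    and "\<And>d x. \<lbrakk>d \<in> \<Delta>; x \<in> I\<rbrakk> \<Longrightarrow> d x \<in> I"
    and "\<And>x. \<lbrakk>x \<in> carrier R; x \<otimes> x \<in> I\<rbrakk> \<Longrightarrow> x \<in> I"
  shows "semiprime_diff_ideal R \<Delta> I"
  unfolding semiprime_diff_ideal_def diff_ideal_def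
  using assms(5,6) ideal_if_mult_closed[OF assms(1-4)] by metis

text \<open>From \<open>a x \<in> M\<close> one gets \<open>a' x + a x' \<in> M\<close>; multiplying by \<open>a x'\<close> yields
  \<open>(a x')\<^sup>2 \<in> M\<close>.\<close>

lemma semiprime_diff_ideal_colon:
  assumes M: "semiprime_diff_ideal R \<Delta> M" and a: "a \<in> carrier R"
  shows "semiprime_diff_ideal R \<Delta> {x \<in> carrier R. a \<otimes> x \<in> M}"
proof -
  interpret M: ideal M R
    using M by (rule semiprime_diff_idealD)
  have der: "a \<otimes> d x \<in> M" if "d \<in> \<Delta>" "x \<in> carrier R" "a \<otimes> x \<in> M" for d x
  proof -
    note c = that a der_closed[OF that(1) that(2)] der_closed[OF that(1) a]
    have "d a \<otimes> x \<oplus> a \<otimes> d x \<in> M"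
      using semiprime_diff_idealD(2)[OF M that(1,3)] der_mult[OF that(1) a that(2)] by simp
    then have "(a \<otimes> d x) \<otimes> (d a \<otimes> x \<oplus> a \<otimes> d x) \<in> M"
      using c(2,4-) by (intro M.I_l_closed) simp_all
    moreover have "(d x \<otimes> d a) \<otimes> (a \<otimes> x) \<in> M"
      using c by (intro M.I_l_closed[of "a \<otimes> x" "d x \<otimes> d a"]) simp_all
    ultimately have "(a \<otimes> d x) \<otimes> (d a \<otimes> x \<oplus> a \<otimes> d x) \<ominus> (d x \<otimes> d a) \<otimes> (a \<otimes> x) \<in> M"
      unfolding minus_eq by (intro M.a_closed M.a_inv_closed)
    also have "(a \<otimes> d x) \<otimes> (d a \<otimes> x \<oplus> a \<otimes> d x) \<ominus> (d x \<otimes> d a) \<otimes> (a \<otimes> x)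
        = (a \<otimes> d x) \<otimes> (a \<otimes> d x)"
      using c(2,4-) by algebra
    finally show ?thesis
      using semiprime_diff_idealD(3)[OF M, of "a \<otimes> d x"] c(4-) by simp
  qed
  show ?thesis
  proof (rule semiprime_diff_idealI)
    fix r x assume rx: "r \<in> carrier R" "x \<in> {x \<in> carrier R. a \<otimes> x \<in> M}"
    then have "r \<otimes> (a \<otimes> x) \<in> M"
      by (simp add: M.I_l_closed)
    moreover have "r \<otimes> (a \<otimes> x) = a \<otimes> (r \<otimes> x)"
      using rx a by (auto intro: m_lcomm)
    ultimately show "r \<otimes> x \<in> {x \<in> carrier R. a \<otimes> x \<in> M}"
      using rx by auto
  next
    fix x assume x: "x \<in> carrier R" "x \<otimes> x \<in> {x \<in> carrier R. a \<otimes> x \<in> M}"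
    then have "a \<otimes> (a \<otimes> (x \<otimes> x)) \<in> M"
      using a by (simp add: M.I_l_closed)
    moreover have "a \<otimes> (a \<otimes> (x \<otimes> x)) = (a \<otimes> x) \<otimes> (a \<otimes> x)"
      using x(1) a by algebra
    ultimately show "x \<in> {x \<in> carrier R. a \<otimes> x \<in> M}"
      using semiprime_diff_idealD(3)[OF M, of "a \<otimes> x"] x a by auto
  qed (use a der in \<open>auto simp: r_distr M.a_closed\<close>)
qed

text \<open>Supplies the upper bounds for Zorn's lemma; the chain condition puts any two summands
  into a common member.\<close>

lemma semiprime_diff_ideal_Union_chain:
  assumes "\<C> \<noteq> {}" and semiprime: "\<And>I. I \<in> \<C> \<Longrightarrow> semiprime_diff_ideal R \<Delta> I"
    and chain: "\<And>I J. \<lbrakk>I \<in> \<C>; J \<in> \<C>\<rbrakk> \<Longrightarrow> I \<subseteq> J \<or> J \<subseteq> I"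
  shows "semiprime_diff_ideal R \<Delta> (\<Union>\<C>)"
proof (rule semiprime_diff_idealI)
  have ideal: "ideal I R" if "I \<in> \<C>" for I
    using semiprime_diff_idealD(1)[OF semiprime[OF that]] .
  show "\<Union>\<C> \<subseteq> carrier R"
    using ideal.Icarr[OF ideal] by (meson UnionE subsetI)
  show "\<zero> \<in> \<Union>\<C>"
    using assms(1) additive_subgroup.zero_closed[OF ideal.axioms(1)[OF ideal]]
    by (meson UnionI ex_in_conv)
  show "x \<oplus> y \<in> \<Union>\<C>" if xy: "x \<in> \<Union>\<C>" "y \<in> \<Union>\<C>" for x y
  proof -
    obtain I where "I \<in> \<C>" "x \<in> I" "y \<in> I"
      using xy chain by (meson UnionE subsetD)
    then show ?thesis
      using additive_subgroup.a_closed[OF ideal.axioms(1)[OF ideal]] by (meson UnionI)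
  qed
  show "r \<otimes> x \<in> \<Union>\<C>" if "r \<in> carrier R" "x \<in> \<Union>\<C>" for r x
    using that ideal.I_l_closed[OF ideal] by (meson UnionE UnionI)
  show "d x \<in> \<Union>\<C>" if "d \<in> \<Delta>" "x \<in> \<Union>\<C>" for d x
    using that semiprime_diff_idealD(2)[OF semiprime] by (meson UnionE UnionI)
  show "x \<in> \<Union>\<C>" if "x \<in> carrier R" "x \<otimes> x \<in> \<Union>\<C>" for x
    using that semiprime_diff_idealD(3)[OF semiprime] by (meson UnionE UnionI)
qed

text \<open>A semiprime differential ideal \<open>M\<close> that is maximal among those containing
  \<open>I\<close> and missing \<open>s\<close> is prime. Otherwise the colon ideals of
  \<open>M\<close> by \<open>a\<close> and then by \<open>s\<close> are strictly larger, hence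
  contain \<open>s\<close>, and \<open>s \<otimes> s \<in> M\<close> contradicts
  \<open>s \<notin> M\<close>.\<close>

lemma exists_diff_prime_avoiding:
  assumes I: "semiprime_diff_ideal R \<Delta> I" and s: "s \<in> carrier R" "s \<notin> I"
  obtains p where "p \<in> dspec R \<Delta>" "I \<subseteq> p" "s \<notin> p"
proof -
  define \<A> where "\<A> = {J. semiprime_diff_ideal R \<Delta> J \<and> I \<subseteq> J \<and> s \<notin> J}"
  have "\<exists>M\<in>\<A>. \<forall>X\<in>\<A>. M \<subseteq> X \<longrightarrow> X = M"
  proof (rule subset_Zorn_nonempty)
    show "\<A> \<noteq> {}"
      using I s by (auto simp: \<A>_def)
    fix \<C> assume "\<C> \<noteq> {}" and C: "subset.chain \<A> \<C>"
    then have "semiprime_diff_ideal R \<Delta> (\<Union>\<C>)"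
      by (intro semiprime_diff_ideal_Union_chain) (auto simp: subset.chain_def \<A>_def)
    with \<open>\<C> \<noteq> {}\<close> C show "\<Union>\<C> \<in> \<A>"
      by (auto simp: subset.chain_def \<A>_def)
  qed
  then obtain M where M: "semiprime_diff_ideal R \<Delta> M" "I \<subseteq> M" "s \<notin> M"
    and max: "\<And>X. \<lbrakk>semiprime_diff_ideal R \<Delta> X; M \<subseteq> X; s \<notin> X\<rbrakk> \<Longrightarrow> X = M"
    unfolding \<A>_def by (smt (verit) mem_Collect_eq subset_trans)
  interpret M: ideal M R
    using M(1) by (rule semiprime_diff_idealD)
  have colon_sub: "M \<subseteq> {x \<in> carrier R. a \<otimes> x \<in> M}" if "a \<in> carrier R" for a
    using that M.Icarr M.I_l_closed by blast
  have "primeideal M R"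
  proof (rule primeidealI)
    show "ideal M R" "cring R" by (fact M.is_ideal) unfold_locales
    show "carrier R \<noteq> M"
      using s M by blast
    fix a b assume ab: "a \<in> carrier R" "b \<in> carrier R" "a \<otimes> b \<in> M"
    show "a \<in> M \<or> b \<in> M"
    proof (rule ccontr)
      assume notin: "\<not> (a \<in> M \<or> b \<in> M)"
      \<comment> \<open>\<open>b\<close> lies in the colon ideal by \<open>a\<close> but not in
        \<open>M\<close>, so maximality forces \<open>s\<close> into this ideal.\<close>
      have "s \<in> {x \<in> carrier R. a \<otimes> x \<in> M}"
        using max[OF semiprime_diff_ideal_colon[OF M(1) ab(1)] colon_sub[OF ab(1)]] ab notin
        by blast
      then have "a \<in> {x \<in> carrier R. s \<otimes> x \<in> M}"
        using ab s by (simp add: m_comm)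
      \<comment> \<open>The same argument for the colon ideal by \<open>s\<close>; now
        \<open>a\<close> is the element outside \<open>M\<close>.\<close>
      then have "s \<in> {x \<in> carrier R. s \<otimes> x \<in> M}"
        using max[OF semiprime_diff_ideal_colon[OF M(1) s(1)] colon_sub[OF s(1)]] notin
        by blast
      then show False
        using semiprime_diff_idealD(3)[OF M(1) s(1)] M(3) by simp
    qed
  qed
  then have "M \<in> dspec R \<Delta>"
    using semiprime_diff_idealD(2)[OF M(1)] by (simp add: dspec_def)
  then show ?thesis
    using that M by blast
qed

end

section \<open>Nilpotents in Keigher rings\<close>

locale keigher_cring = diff_cring +
  assumes nilradical: "diff_ideal R \<Delta> (ring_radical R {\<zero>})"
begin

text \<open>The nilradical is itself a semiprime differential ideal, so an element outside it would
  be missed by some differential prime.\<close>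

lemma nilpotent_if_in_all_diff_primes:
  assumes a: "a \<in> carrier R" "\<And>p. p \<in> dspec R \<Delta> \<Longrightarrow> a \<in> p"
  shows "\<exists>n::nat. a [^] n = \<zero>"
proof -
  have "semiprime_diff_ideal R \<Delta> (ring_radical R {\<zero>})"
    unfolding semiprime_diff_ideal_def
  proof (intro conjI ballI impI nilradical)
    fix x assume x: "x \<in> carrier R" "x \<otimes> x \<in> ring_radical R {\<zero>}"
    then obtain n :: nat where "(x \<otimes> x) [^] n = \<zero>"
      by (auto simp: ring_radical_def)
    then have "x [^] (n + n) = \<zero>"
      using nat_pow_distrib[of x x n] nat_pow_mult[of x n n] x(1) by simp
    then show "x \<in> ring_radical R {\<zero>}"
      using x by (auto simp: ring_radical_def)
  qed
  then have "a \<in> ring_radical R {\<zero>}"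
    using exists_diff_prime_avoiding[of "ring_radical R {\<zero>}" a] a by metis
  then show ?thesis
    by (simp add: ring_radical_def)
qed

end

text \<open>The Keigher condition is applied to the zero ideal, which is differential because
  derivations kill zero.\<close>

lemma keigher_ring_imp_keigher_cring:
  assumes "keigher_ring R \<Delta>"
  shows "keigher_cring R \<Delta>"
proof -
  interpret cring R
    using assms by (simp add: keigher_ring_def diff_ring_def)
  interpret diff_cring R \<Delta>
    using assms by unfold_locales (simp add: keigher_ring_def diff_ring_def)
  have "diff_ideal R \<Delta> {\<zero>\<^bsub>R\<^esub>}"
    by (simp add: diff_ideal_def zeroideal der_zero)
  then show ?thesis
    using assms by unfold_locales (simp add: keigher_ring_def)
qed

subsection \<open>The Kolchin topology\<close>

lemma dspecD:
  assumes "p \<in> dspec R \<Delta>"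
  shows "primeideal p R" "\<lbrakk>d \<in> \<Delta>; x \<in> p\<rbrakk> \<Longrightarrow> d x \<in> p"
  using assms by (auto simp: dspec_def)

lemma (in primeideal) one_notin: "\<one> \<notin> I"
  using one_imp_carrier I_notcarr by blast

lemma (in primeideal) mult_in_iff:
  "\<lbrakk>a \<in> carrier R; b \<in> carrier R\<rbrakk> \<Longrightarrow> a \<otimes> b \<in> I \<longleftrightarrow> a \<in> I \<or> b \<in> I"
  by (rule iffI, erule (2) I_prime) (auto simp: I_l_closed I_r_closed)

lemma (in primeideal) pow_notin:
  "\<lbrakk>a \<in> carrier R; a \<notin> I\<rbrakk> \<Longrightarrow> a [^] (n::nat) \<notin> I"
  by (induction n) (simp_all add: one_notin mult_in_iff)

text \<open>The sets D(h) of differential primes missing a single \<open>h\<close> form a basis. The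
  set \<open>E\<close> in \<open>kolchin_open\<close> may leave the carrier, whereas here
  \<open>h\<close> is a ring element, so that later arguments can multiply with it.\<close>

lemma kolchin_open_iff:
  fixes R (structure)
  shows "kolchin_open R \<Delta> W \<longleftrightarrow> W \<subseteq> dspec R \<Delta> \<and>
    (\<forall>p\<in>W. \<exists>h\<in>carrier R - p. \<forall>q\<in>dspec R \<Delta>. h \<notin> q \<longrightarrow> q \<in> W)" (is "_ \<longleftrightarrow> ?rhs")
proof
  assume "kolchin_open R \<Delta> W"
  then obtain E where E: "W = {p \<in> dspec R \<Delta>. \<not> E \<subseteq> p}"
    by (auto simp: kolchin_open_def kolchin_V_def)
  have "\<exists>h\<in>carrier R - p. \<forall>q\<in>dspec R \<Delta>. h \<notin> q \<longrightarrow> q \<in> W" if p: "p \<in> W" for p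
  proof (cases "E \<subseteq> carrier R")
    case True
    with p E show ?thesis by blast
  next
    \<comment> \<open>No ideal contains \<open>E\<close>, so \<open>W\<close> is everything.\<close>
    case False
    interpret primeideal p R
      using p E by (auto dest: dspecD)
    have "q \<subseteq> carrier R" if "q \<in> dspec R \<Delta>" for q
      using ideal.Icarr[OF primeideal.axioms(1)[OF dspecD(1)[OF that]]] by blast
    with False E have "W = dspec R \<Delta>"
      by blast
    then show ?thesis
      using one_notin by blast
  qed
  then show ?rhs
    using E by blast
next
  assume ?rhs
  \<comment> \<open>The witness for \<open>E\<close> is the set of all ring elements
    \<open>h\<close> with D(h) inside \<open>W\<close>.\<close>
  then have "W = dspec R \<Delta> - kolchin_V R \<Delta> {h \<in> carrier R. \<forall>q\<in>dspec R \<Delta>. h \<notin> q \<longrightarrow> q \<in> W}"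
    unfolding kolchin_V_def by blast
  then show "kolchin_open R \<Delta> W"
    unfolding kolchin_open_def by blast
qed

text \<open>Intersections work because D(h) \<inter> D(k) = D(h k), the points being prime
  ideals.\<close>

lemma istopology_kolchin: "istopology (kolchin_open R \<Delta>)"
  unfolding istopology_def
proof (intro conjI allI impI)
  fix U V assume UV: "kolchin_open R \<Delta> U" "kolchin_open R \<Delta> V"
  show "kolchin_open R \<Delta> (U \<inter> V)"
    unfolding kolchin_open_iff
  proof (intro conjI ballI)
    show "U \<inter> V \<subseteq> dspec R \<Delta>"
      using UV by (auto simp: kolchin_open_iff)
    fix p assume p: "p \<in> U \<inter> V"
    obtain h k where h: "h \<in> carrier R - p" "\<forall>q\<in>dspec R \<Delta>. h \<notin> q \<longrightarrow> q \<in> U"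
      and k: "k \<in> carrier R - p" "\<forall>q\<in>dspec R \<Delta>. k \<notin> q \<longrightarrow> q \<in> V"
      using UV p unfolding kolchin_open_iff by (metis IntE)
    interpret primeideal p R
      using p UV by (auto simp: kolchin_open_iff dest: dspecD)
    show "\<exists>g\<in>carrier R - p. \<forall>q\<in>dspec R \<Delta>. g \<notin> q \<longrightarrow> q \<in> U \<inter> V"
    proof (intro bexI ballI impI)
      show "h \<otimes>\<^bsub>R\<^esub> k \<in> carrier R - p"
        using h k mult_in_iff by auto
      fix q assume "q \<in> dspec R \<Delta>" "h \<otimes>\<^bsub>R\<^esub> k \<notin> q"
      then show "q \<in> U \<inter> V"
        using h k primeideal.mult_in_iff[of q R h k] dspecD(1)[of q R \<Delta>] by auto
    qed
  qed
next
  fix \<K> assume "\<forall>K\<in>\<K>. kolchin_open R \<Delta> K"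
  then show "kolchin_open R \<Delta> (\<Union>\<K>)"
    unfolding kolchin_open_iff by (meson Sup_least UnionE UnionI)
qed

lemma openin_kolchin: "openin (kolchin_topology R \<Delta>) = kolchin_open R \<Delta>"
  by (simp add: kolchin_topology_def istopology_kolchin)

text \<open>The whole spectrum is D(1), since no prime contains the unit.\<close>

lemma topspace_kolchin: "topspace (kolchin_topology R \<Delta>) = dspec R \<Delta>"
proof
  show "topspace (kolchin_topology R \<Delta>) \<subseteq> dspec R \<Delta>"
    by (auto simp: topspace_def openin_kolchin kolchin_open_iff)
  have "kolchin_open R \<Delta> (dspec R \<Delta>)"
    unfolding kolchin_open_iff
  proof (intro conjI ballI)
    fix p assume "p \<in> dspec R \<Delta>"
    then interpret primeideal p R
      by (rule dspecD)
    show "\<exists>h\<in>carrier R - p. \<forall>q\<in>dspec R \<Delta>. h \<notin> q \<longrightarrow> q \<in> dspec R \<Delta>"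
      using one_notin by blast
  qed simp
  then show "dspec R \<Delta> \<subseteq> topspace (kolchin_topology R \<Delta>)"
    by (auto simp: topspace_def openin_kolchin)
qed

subsection \<open>Localization at a prime\<close>

context primeideal
begin

text \<open>\<open>loc_frac\<close> is the equivalence class of the pair \<open>(a, s)\<close>. The
  forward direction is reflexivity; the backward one is transitivity, applied both ways through
  symmetry.\<close>

lemma loc_frac_eq_iff:
  assumes a: "a \<in> carrier R" "b \<in> carrier R" and s: "s \<in> carrier R - I" "t \<in> carrier R - I"
  shows "loc_frac R I a s = loc_frac R I b t \<longleftrightarrow>
    (\<exists>u\<in>carrier R - I. u \<otimes> (a \<otimes> t \<ominus> b \<otimes> s) = \<zero>)" (is "_ \<longleftrightarrow> ?rhs")
proof
  assume eq: "loc_frac R I a s = loc_frac R I b t"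
  have "(b, t) \<in> loc_frac R I b t"
    using assms one_notin by (auto simp: loc_frac_def r_neg minus_eq intro!: bexI[of _ \<one>])
  then show ?rhs
    unfolding eq[symmetric] by (simp add: loc_frac_def)
next
  have sub: "loc_frac R I b t \<subseteq> loc_frac R I a s"
    if c: "a \<in> carrier R" "b \<in> carrier R" "s \<in> carrier R - I" "t \<in> carrier R - I"
      "u \<in> carrier R - I" and z: "u \<otimes> (a \<otimes> t \<ominus> b \<otimes> s) = \<zero>" for a b s t u
  proof safe
    fix e w assume "(e, w) \<in> loc_frac R I b t"
    then obtain v where e: "e \<in> carrier R" "w \<in> carrier R - I" "v \<in> carrier R - I"
      and zv: "v \<otimes> (b \<otimes> w \<ominus> e \<otimes> t) = \<zero>"
      by (auto simp: loc_frac_def)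
    have k: "s \<in> carrier R" "t \<in> carrier R" "u \<in> carrier R" "v \<in> carrier R" "w \<in> carrier R"
      using c e by auto
    \<comment> \<open>The underlying identity is
      \<open>t (a w - e s) = w (a t - b s) + s (b w - e t)\<close>; \<open>u\<close> kills the first
      term on the right and \<open>v\<close> the second.\<close>
    have "(u \<otimes> v \<otimes> t) \<otimes> (a \<otimes> w \<ominus> e \<otimes> s)
        = (v \<otimes> w) \<otimes> (u \<otimes> (a \<otimes> t \<ominus> b \<otimes> s)) \<oplus> (u \<otimes> s) \<otimes> (v \<otimes> (b \<otimes> w \<ominus> e \<otimes> t))"
      using c(1,2) e(1) k by algebra
    also have "\<dots> = \<zero>"
      using k by (simp add: z zv)
    finally show "(e, w) \<in> loc_frac R I a s"
      using c e by (auto simp: loc_frac_def mult_in_iff intro!: bexI[of _ "u \<otimes> v \<otimes> t"])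
  qed
  assume ?rhs
  then obtain u where u: "u \<in> carrier R - I" "u \<otimes> (a \<otimes> t \<ominus> b \<otimes> s) = \<zero>"
    by blast
  have k: "s \<in> carrier R" "t \<in> carrier R" "u \<in> carrier R"
    using s u by auto
  have "u \<otimes> (b \<otimes> s \<ominus> a \<otimes> t) = \<ominus> (u \<otimes> (a \<otimes> t \<ominus> b \<otimes> s))"
    using a k by algebra
  then have "u \<otimes> (b \<otimes> s \<ominus> a \<otimes> t) = \<zero>"
    by (simp add: u)
  then show "loc_frac R I a s = loc_frac R I b t"
    using sub[OF a s u] sub[OF a(2,1) s(2,1) u(1)] by blast
qed

lemma loc_frac_eqI:
  assumes "a \<in> carrier R" "b \<in> carrier R" "s \<in> carrier R - I" "t \<in> carrier R - I"
    and "a \<otimes> t = b \<otimes> s"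
  shows "loc_frac R I a s = loc_frac R I b t"
  unfolding loc_frac_eq_iff[OF assms(1-4)] using assms one_notin
  by (intro bexI[of _ \<one>]) (simp_all add: r_neg minus_eq)

lemma loc_frac_eq_zero_iff:
  assumes "a \<in> carrier R" "s \<in> carrier R - I"
  shows "loc_frac R I a s = loc_frac R I \<zero> \<one> \<longleftrightarrow> (\<exists>u\<in>carrier R - I. u \<otimes> a = \<zero>)"
  using assms one_notin by (subst loc_frac_eq_iff) (auto simp: minus_eq)

text \<open>Equality of the fractions gives \<open>u a t = u b s\<close> with \<open>u\<close>,
  \<open>s\<close>, \<open>t\<close> outside the prime. Hence lying in the maximal ideal of the
  localization can be read off from any numerator.\<close>

lemma loc_frac_eq_imp_num_mem_iff:
  assumes c: "a \<in> carrier R" "b \<in> carrier R" "s \<in> carrier R - I" "t \<in> carrier R - I"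
    and eq: "loc_frac R I a s = loc_frac R I b t"
  shows "a \<in> I \<longleftrightarrow> b \<in> I"
proof -
  obtain u where u: "u \<in> carrier R - I" "u \<otimes> (a \<otimes> t \<ominus> b \<otimes> s) = \<zero>"
    using eq loc_frac_eq_iff[OF c] by blast
  have k: "s \<in> carrier R" "t \<in> carrier R" "u \<in> carrier R" "s \<notin> I" "t \<notin> I" "u \<notin> I"
    using c u by auto
  have "u \<otimes> (a \<otimes> t) = u \<otimes> (a \<otimes> t \<ominus> b \<otimes> s) \<oplus> u \<otimes> (b \<otimes> s)"
    using c(1,2) k(1-3) by algebra
  then have "u \<otimes> (a \<otimes> t) = u \<otimes> (b \<otimes> s)"
    using c(1,2) k by (simp add: u)
  then have "u \<otimes> (a \<otimes> t) \<in> I \<longleftrightarrow> u \<otimes> (b \<otimes> s) \<in> I"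
    by simp
  then show ?thesis
    using c(1,2) k by (simp add: mult_in_iff)
qed

text \<open>The operations on the localization act on a representative picked by Hilbert choice.
  That it represents the same fraction is enough to compute these operations from any other
  representative.\<close>

lemma loc_rep_frac:
  assumes c: "a \<in> carrier R" "s \<in> carrier R - I"
  obtains b t where "loc_rep (loc_frac R I a s) = (b, t)" "b \<in> carrier R" "t \<in> carrier R - I"
    "loc_frac R I b t = loc_frac R I a s"
proof -
  have "(a, s) \<in> loc_frac R I a s"
    using c one_notin by (auto simp: loc_frac_def r_neg minus_eq intro!: bexI[of _ \<one>])
  then have mem: "loc_rep (loc_frac R I a s) \<in> loc_frac R I a s"
    unfolding loc_rep_def by (rule someI)
  obtain b t where bt: "loc_rep (loc_frac R I a s) = (b, t)"
    by (cases "loc_rep (loc_frac R I a s)")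
  then have "b \<in> carrier R" "t \<in> carrier R - I"
    "\<exists>u\<in>carrier R - I. u \<otimes> (a \<otimes> t \<ominus> b \<otimes> s) = \<zero>"
    using mem by (auto simp: loc_frac_def)
  moreover from this have "loc_frac R I a s = loc_frac R I b t"
    using loc_frac_eq_iff c by blast
  ultimately show ?thesis
    using that[OF bt] by simp
qed

text \<open>Independence of the representatives: if \<open>u\<close> and \<open>v\<close> witness
  the equality of the chosen fractions with the given ones, then \<open>u \<otimes> v\<close>
  witnesses that of the sums.\<close>

lemma loc_add_frac:
  assumes c: "a \<in> carrier R" "b \<in> carrier R" "s \<in> carrier R - I" "t \<in> carrier R - I"
  shows "loc_add R I (loc_frac R I a s) (loc_frac R I b t) = loc_frac R I (a \<otimes> t \<oplus> b \<otimes> s) (s \<otimes> t)"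
proof -
  obtain a' s' where 1: "loc_rep (loc_frac R I a s) = (a', s')" "a' \<in> carrier R" "s' \<in> carrier R - I"
    "loc_frac R I a' s' = loc_frac R I a s"
    using loc_rep_frac c by metis
  obtain b' t' where 2: "loc_rep (loc_frac R I b t) = (b', t')" "b' \<in> carrier R" "t' \<in> carrier R - I"
    "loc_frac R I b' t' = loc_frac R I b t"
    using loc_rep_frac c by metis
  obtain u where u: "u \<in> carrier R - I" "u \<otimes> (a' \<otimes> s \<ominus> a \<otimes> s') = \<zero>"
    using loc_frac_eq_iff[OF 1(2) c(1) 1(3) c(3)] 1(4) by blast
  obtain v where v: "v \<in> carrier R - I" "v \<otimes> (b' \<otimes> t \<ominus> b \<otimes> t') = \<zero>"
    using loc_frac_eq_iff[OF 2(2) c(2) 2(3) c(4)] 2(4) by blast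
  have k: "s \<in> carrier R" "t \<in> carrier R" "s' \<in> carrier R" "t' \<in> carrier R" "u \<in> carrier R"
    "v \<in> carrier R"
    using c 1 2 u v by auto
  have "(u \<otimes> v) \<otimes> ((a' \<otimes> t' \<oplus> b' \<otimes> s') \<otimes> (s \<otimes> t) \<ominus> (a \<otimes> t \<oplus> b \<otimes> s) \<otimes> (s' \<otimes> t'))
      = (v \<otimes> t \<otimes> t') \<otimes> (u \<otimes> (a' \<otimes> s \<ominus> a \<otimes> s')) \<oplus> (u \<otimes> s \<otimes> s') \<otimes> (v \<otimes> (b' \<otimes> t \<ominus> b \<otimes> t'))"
    using c(1,2) 1(2) 2(2) k by algebra
  also have "\<dots> = \<zero>"
    using k by (simp add: u v)
  finally have "loc_frac R I (a' \<otimes> t' \<oplus> b' \<otimes> s') (s' \<otimes> t') = loc_frac R I (a \<otimes> t \<oplus> b \<otimes> s) (s \<otimes> t)"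
    using c 1 2 u v by (subst loc_frac_eq_iff) (auto simp: mult_in_iff intro!: bexI[of _ "u \<otimes> v"])
  then show ?thesis
    by (simp add: loc_add_def 1(1) 2(1))
qed

text \<open>As for sums, now from the identity \<open>a' b' s t - a b s' t' = b' t (a' s - a s') + a
  s' (b' t - b t')\<close>.\<close>

lemma loc_mult_frac:
  assumes c: "a \<in> carrier R" "b \<in> carrier R" "s \<in> carrier R - I" "t \<in> carrier R - I"
  shows "loc_mult R I (loc_frac R I a s) (loc_frac R I b t) = loc_frac R I (a \<otimes> b) (s \<otimes> t)"
proof -
  obtain a' s' where 1: "loc_rep (loc_frac R I a s) = (a', s')" "a' \<in> carrier R" "s' \<in> carrier R - I"
    "loc_frac R I a' s' = loc_frac R I a s"
    using loc_rep_frac c by metis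
  obtain b' t' where 2: "loc_rep (loc_frac R I b t) = (b', t')" "b' \<in> carrier R" "t' \<in> carrier R - I"
    "loc_frac R I b' t' = loc_frac R I b t"
    using loc_rep_frac c by metis
  obtain u where u: "u \<in> carrier R - I" "u \<otimes> (a' \<otimes> s \<ominus> a \<otimes> s') = \<zero>"
    using loc_frac_eq_iff[OF 1(2) c(1) 1(3) c(3)] 1(4) by blast
  obtain v where v: "v \<in> carrier R - I" "v \<otimes> (b' \<otimes> t \<ominus> b \<otimes> t') = \<zero>"
    using loc_frac_eq_iff[OF 2(2) c(2) 2(3) c(4)] 2(4) by blast
  have k: "s \<in> carrier R" "t \<in> carrier R" "s' \<in> carrier R" "t' \<in> carrier R" "u \<in> carrier R"
    "v \<in> carrier R"
    using c 1 2 u v by auto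
  have "(u \<otimes> v) \<otimes> ((a' \<otimes> b') \<otimes> (s \<otimes> t) \<ominus> (a \<otimes> b) \<otimes> (s' \<otimes> t'))
      = (v \<otimes> b' \<otimes> t) \<otimes> (u \<otimes> (a' \<otimes> s \<ominus> a \<otimes> s')) \<oplus> (u \<otimes> a \<otimes> s') \<otimes> (v \<otimes> (b' \<otimes> t \<ominus> b \<otimes> t'))"
    using c(1,2) 1(2) 2(2) k by algebra
  also have "\<dots> = \<zero>"
    using c(1,2) 1(2) 2(2) k by (simp add: u v)
  finally have "loc_frac R I (a' \<otimes> b') (s' \<otimes> t') = loc_frac R I (a \<otimes> b) (s \<otimes> t)"
    using c 1 2 u v by (subst loc_frac_eq_iff) (auto simp: mult_in_iff intro!: bexI[of _ "u \<otimes> v"])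
  then show ?thesis
    by (simp add: loc_mult_def 1(1) 2(1))
qed

end

text \<open>If \<open>u c = 0\<close> with \<open>c = a t - b s\<close>, then \<open>u\<^sup>2 c' = 0\<close>, and the cross difference of the two
  derived fractions is \<open>s t c' - (s' t + t' s) c\<close>.\<close>

lemma (in diff_cring) loc_der_frac:
  assumes "primeideal p R" and d: "d \<in> \<Delta>" and c: "a \<in> carrier R" "s \<in> carrier R - p"
  shows "loc_der R p d (loc_frac R p a s) = loc_frac R p (d a \<otimes> s \<ominus> a \<otimes> d s) (s \<otimes> s)"
proof -
  interpret p: primeideal p R by fact
  obtain b t where 1: "loc_rep (loc_frac R p a s) = (b, t)" "b \<in> carrier R" "t \<in> carrier R - p"
    "loc_frac R p b t = loc_frac R p a s"
    using p.loc_rep_frac c by metis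
  obtain u where u: "u \<in> carrier R - p" "u \<otimes> (b \<otimes> s \<ominus> a \<otimes> t) = \<zero>"
    using p.loc_frac_eq_iff[OF 1(2) c(1) 1(3) c(2)] 1(4) by blast
  have k: "a \<in> carrier R" "b \<in> carrier R" "s \<in> carrier R" "t \<in> carrier R" "u \<in> carrier R"
    using c 1 u by auto
  note dk = k[THEN der_closed[OF d]]
  define e where "e = b \<otimes> s \<ominus> a \<otimes> t"
  have e: "e \<in> carrier R" "u \<otimes> e = \<zero>"
    using k u by (simp_all add: e_def)
  have de: "d e = (d b \<otimes> s \<oplus> b \<otimes> d s) \<ominus> (d a \<otimes> t \<oplus> a \<otimes> d t)"
    using d k by (simp add: e_def der_minus der_mult)
  have "d u \<otimes> e \<oplus> u \<otimes> d e = \<zero>"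
    using der_mult[OF d k(5) e(1)] by (simp add: e(2) der_zero d)
  moreover have "u \<otimes> (d u \<otimes> e \<oplus> u \<otimes> d e) = d u \<otimes> (u \<otimes> e) \<oplus> (u \<otimes> u) \<otimes> d e"
    using k(5) dk(5) e(1) der_closed[OF d e(1)] by algebra
  ultimately have uude: "(u \<otimes> u) \<otimes> d e = \<zero>"
    using k(5) dk(5) e der_closed[OF d e(1)] by simp
  have "(u \<otimes> u) \<otimes> ((d b \<otimes> t \<ominus> b \<otimes> d t) \<otimes> (s \<otimes> s) \<ominus> (d a \<otimes> s \<ominus> a \<otimes> d s) \<otimes> (t \<otimes> t))
      = (s \<otimes> t) \<otimes> ((u \<otimes> u) \<otimes> d e) \<ominus> ((u \<otimes> (d s \<otimes> t \<oplus> d t \<otimes> s)) \<otimes> (u \<otimes> e))"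
    unfolding de unfolding e_def using k dk by algebra
  also have "\<dots> = \<zero>"
    using k dk by (simp add: e(2) uude minus_eq)
  finally have "loc_frac R p (d b \<otimes> t \<ominus> b \<otimes> d t) (t \<otimes> t)
      = loc_frac R p (d a \<otimes> s \<ominus> a \<otimes> d s) (s \<otimes> s)"
    using c 1 u dk
    by (subst p.loc_frac_eq_iff) (auto simp: p.mult_in_iff intro!: bexI[of _ "u \<otimes> u"])
  then show ?thesis
    by (simp add: loc_der_def 1(1))
qed

subsection \<open>Differential rings of sections\<close>

locale section_ring = diff_cring +
  fixes D :: "('a set \<Rightarrow> ('a \<times> 'a) set) set"
  assumes D_subring: "subring D (sections_ring R \<Delta>)"
    and iota_closed: "a \<in> carrier R \<Longrightarrow> loc_iota R \<Delta> a \<in> D"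
    and sec_der_closed: "\<lbrakk>d \<in> \<Delta>; f \<in> D\<rbrakk> \<Longrightarrow> sec_der R \<Delta> d f \<in> D"
begin

abbreviation X where "X \<equiv> dspec R \<Delta>"
abbreviation \<iota> where "\<iota> \<equiv> loc_iota R \<Delta>"

definition S where "S = (sections_ring R \<Delta>)\<lparr>carrier := D\<rparr>"

lemma D_sections: "f \<in> D \<Longrightarrow> f \<in> sections R \<Delta>"
  using subgroup.subset[OF subring.axioms(1)[OF D_subring]] by (auto simp: sections_ring_def)

lemma S_add_closed: "\<lbrakk>f \<in> D; g \<in> D\<rbrakk> \<Longrightarrow> f \<oplus>\<^bsub>S\<^esub> g \<in> D"
  using subgroup.m_closed[OF subring.axioms(1)[OF D_subring]] by (simp add: S_def)

lemma S_mult_closed: "\<lbrakk>f \<in> D; g \<in> D\<rbrakk> \<Longrightarrow> f \<otimes>\<^bsub>S\<^esub> g \<in> D"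
  using submonoid.m_closed[OF subring.axioms(2)[OF D_subring]] by (simp add: S_def)

lemma carrier_S [simp]: "carrier S = D"
  by (simp add: S_def)

lemma zero_S: "\<zero>\<^bsub>S\<^esub> = \<iota> \<zero>"
  by (simp add: S_def sections_ring_def)

lemma one_S: "\<one>\<^bsub>S\<^esub> = \<iota> \<one>"
  by (simp add: S_def sections_ring_def)

lemma add_apply: "p \<in> X \<Longrightarrow> (f \<oplus>\<^bsub>S\<^esub> g) p = loc_add R p (f p) (g p)"
  by (simp add: S_def sections_ring_def)

lemma mult_apply: "p \<in> X \<Longrightarrow> (f \<otimes>\<^bsub>S\<^esub> g) p = loc_mult R p (f p) (g p)"
  by (simp add: S_def sections_ring_def)

lemma iota_apply: "p \<in> X \<Longrightarrow> \<iota> a p = loc_frac R p a \<one>"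
  by (simp add: loc_iota_def)

lemma primeideal_X: "p \<in> X \<Longrightarrow> primeideal p R"
  by (rule dspecD)

text \<open>Outside \<open>X\<close> every section has the dummy value \<open>{}\<close>, so only
  the points of \<open>X\<close> matter.\<close>

lemma section_eqI:
  assumes "f \<in> D" "g \<in> D" "\<And>p. p \<in> X \<Longrightarrow> f p = g p"
  shows "f = g"
proof
  fix p show "f p = g p"
    using assms D_sections[OF assms(1)] D_sections[OF assms(2)]
    by (cases "p \<in> X") (auto simp: sections_def)
qed

lemma section_frac:
  assumes "f \<in> D" "p \<in> X"
  obtains a s where "f p = loc_frac R p a s" "a \<in> carrier R" "s \<in> carrier R - p"
  using assms D_sections[OF assms(1)] by (auto simp: sections_def loc_elems_def)

text \<open>This is regularity at \<open>p\<close>, with the neighbourhood shrunk to a basic open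
  set D(h).\<close>

lemma section_locally_frac:
  assumes "f \<in> D" "p \<in> X"
  obtains h a b where "h \<in> carrier R - p" "a \<in> carrier R" "b \<in> carrier R"
    "\<And>q. \<lbrakk>q \<in> X; h \<notin> q\<rbrakk> \<Longrightarrow> b \<notin> q \<and> f q = loc_frac R q a b"
proof -
  obtain W a b where W: "kolchin_open R \<Delta> W" "p \<in> W" and ab: "a \<in> carrier R" "b \<in> carrier R"
    "\<And>q. q \<in> W \<Longrightarrow> b \<notin> q \<and> f q = loc_frac R q a b"
    using D_sections[OF assms(1)] assms(2) unfolding sections_def regular_at_def by fastforce
  obtain h where "h \<in> carrier R - p" "\<forall>q\<in>X. h \<notin> q \<longrightarrow> q \<in> W"
    using W unfolding kolchin_open_iff by blast
  then show ?thesis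
    using that ab by blast
qed

lemma iota_add:
  assumes "a \<in> carrier R" "b \<in> carrier R"
  shows "\<iota> (a \<oplus> b) = \<iota> a \<oplus>\<^bsub>S\<^esub> \<iota> b"
proof (rule section_eqI)
  fix p assume p: "p \<in> X"
  then interpret primeideal p R
    by (rule primeideal_X)
  show "\<iota> (a \<oplus> b) p = (\<iota> a \<oplus>\<^bsub>S\<^esub> \<iota> b) p"
    using assms p by (simp add: add_apply iota_apply loc_add_frac one_notin)
qed (simp_all only: assms iota_closed S_add_closed a_closed)

lemma iota_mult:
  assumes "a \<in> carrier R" "b \<in> carrier R"
  shows "\<iota> (a \<otimes> b) = \<iota> a \<otimes>\<^bsub>S\<^esub> \<iota> b"
proof (rule section_eqI)
  fix p assume p: "p \<in> X"
  then interpret primeideal p R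
    by (rule primeideal_X)
  show "\<iota> (a \<otimes> b) p = (\<iota> a \<otimes>\<^bsub>S\<^esub> \<iota> b) p"
    using assms p by (simp add: mult_apply iota_apply loc_mult_frac one_notin)
qed (simp_all only: assms iota_closed S_mult_closed m_closed)

text \<open>The quotient rule for \<open>a / 1\<close> reduces to \<open>d a / 1\<close> because
  \<open>d \<one> = \<zero>\<close>.\<close>

lemma sec_der_iota:
  assumes "a \<in> carrier R" "d \<in> \<Delta>"
  shows "sec_der R \<Delta> d (\<iota> a) = \<iota> (d a)"
proof (rule section_eqI)
  fix p assume p: "p \<in> X"
  then interpret primeideal p R
    by (rule primeideal_X)
  show "sec_der R \<Delta> d (\<iota> a) p = \<iota> (d a) p"
    using assms p one_notin
    by (simp add: sec_der_def iota_apply loc_der_frac[OF primeideal_X[OF p]] der_one minus_eq)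
qed (simp_all only: assms iota_closed sec_der_closed der_closed)

text \<open>\<open>subring\<close> supplies closure; the ring axioms are checked point by point, as
  identities between fractions in each localization.\<close>

lemma cring_S: "cring S"
proof (rule cringI)
  note closed = S_add_closed S_mult_closed iota_closed
  have one_mult: "\<iota> \<one> \<otimes>\<^bsub>S\<^esub> f = f" if f: "f \<in> D" for f
  proof (rule section_eqI)
    fix p assume p: "p \<in> X"
    then interpret primeideal p R
      by (rule primeideal_X)
    obtain a s where "f p = loc_frac R p a s" "a \<in> carrier R" "s \<in> carrier R - p"
      using section_frac[OF f p] .
    then show "(\<iota> \<one> \<otimes>\<^bsub>S\<^esub> f) p = f p"
      using p by (simp add: mult_apply iota_apply loc_mult_frac one_notin)
  qed (simp_all only: f closed one_closed)
  have mult_comm: "f \<otimes>\<^bsub>S\<^esub> g = g \<otimes>\<^bsub>S\<^esub> f" if fg: "f \<in> D" "g \<in> D" for f g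
  proof (rule section_eqI)
    fix p assume p: "p \<in> X"
    then interpret primeideal p R
      by (rule primeideal_X)
    obtain a s where f: "f p = loc_frac R p a s" "a \<in> carrier R" "s \<in> carrier R - p"
      using section_frac[OF fg(1) p] .
    obtain b t where g: "g p = loc_frac R p b t" "b \<in> carrier R" "t \<in> carrier R - p"
      using section_frac[OF fg(2) p] .
    show "(f \<otimes>\<^bsub>S\<^esub> g) p = (g \<otimes>\<^bsub>S\<^esub> f) p"
      using p f g by (simp add: mult_apply loc_mult_frac m_comm)
  qed (simp_all only: fg closed)
  have add_comm: "f \<oplus>\<^bsub>S\<^esub> g = g \<oplus>\<^bsub>S\<^esub> f" if fg: "f \<in> D" "g \<in> D" for f g
  proof (rule section_eqI)
    fix p assume p: "p \<in> X"
    then interpret primeideal p R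
      by (rule primeideal_X)
    obtain a s where f: "f p = loc_frac R p a s" "a \<in> carrier R" "s \<in> carrier R - p"
      using section_frac[OF fg(1) p] .
    obtain b t where g: "g p = loc_frac R p b t" "b \<in> carrier R" "t \<in> carrier R - p"
      using section_frac[OF fg(2) p] .
    show "(f \<oplus>\<^bsub>S\<^esub> g) p = (g \<oplus>\<^bsub>S\<^esub> f) p"
      using p f g by (simp add: add_apply loc_add_frac m_comm a_comm)
  qed (simp_all only: fg closed)
  have mult_assoc: "(f \<otimes>\<^bsub>S\<^esub> g) \<otimes>\<^bsub>S\<^esub> h = f \<otimes>\<^bsub>S\<^esub> (g \<otimes>\<^bsub>S\<^esub> h)"
    and add_assoc: "(f \<oplus>\<^bsub>S\<^esub> g) \<oplus>\<^bsub>S\<^esub> h = f \<oplus>\<^bsub>S\<^esub> (g \<oplus>\<^bsub>S\<^esub> h)"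
    and distr: "(f \<oplus>\<^bsub>S\<^esub> g) \<otimes>\<^bsub>S\<^esub> h = f \<otimes>\<^bsub>S\<^esub> h \<oplus>\<^bsub>S\<^esub> g \<otimes>\<^bsub>S\<^esub> h"
    if fgh: "f \<in> D" "g \<in> D" "h \<in> D" for f g h
  proof -
    have "((f \<otimes>\<^bsub>S\<^esub> g) \<otimes>\<^bsub>S\<^esub> h) p = (f \<otimes>\<^bsub>S\<^esub> (g \<otimes>\<^bsub>S\<^esub> h)) p \<and>
      ((f \<oplus>\<^bsub>S\<^esub> g) \<oplus>\<^bsub>S\<^esub> h) p = (f \<oplus>\<^bsub>S\<^esub> (g \<oplus>\<^bsub>S\<^esub> h)) p \<and>
      ((f \<oplus>\<^bsub>S\<^esub> g) \<otimes>\<^bsub>S\<^esub> h) p = (f \<otimes>\<^bsub>S\<^esub> h \<oplus>\<^bsub>S\<^esub> g \<otimes>\<^bsub>S\<^esub> h) p" if p: "p \<in> X" for p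
    proof -
      interpret primeideal p R
        using p by (rule primeideal_X)
      obtain a s where f: "f p = loc_frac R p a s" "a \<in> carrier R" "s \<in> carrier R - p"
        using section_frac[OF fgh(1) p] .
      obtain b t where g: "g p = loc_frac R p b t" "b \<in> carrier R" "t \<in> carrier R - p"
        using section_frac[OF fgh(2) p] .
      obtain c u where h: "h p = loc_frac R p c u" "c \<in> carrier R" "u \<in> carrier R - p"
        using section_frac[OF fgh(3) p] .
      have k: "a \<in> carrier R" "b \<in> carrier R" "c \<in> carrier R"
        "s \<in> carrier R" "t \<in> carrier R" "u \<in> carrier R"
        using f g h by auto
      have "(a \<otimes> t \<oplus> b \<otimes> s) \<otimes> u \<oplus> c \<otimes> (s \<otimes> t) = a \<otimes> (t \<otimes> u) \<oplus> (b \<otimes> u \<oplus> c \<otimes> t) \<otimes> s"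
        using k by algebra
      \<comment> \<open>The two sides of distributivity have denominators differing by a factor
        \<open>u\<close>, so they are compared by cross multiplication.\<close>
      moreover have "loc_frac R p ((a \<otimes> t \<oplus> b \<otimes> s) \<otimes> c) (s \<otimes> t \<otimes> u)
          = loc_frac R p ((a \<otimes> c) \<otimes> (t \<otimes> u) \<oplus> (b \<otimes> c) \<otimes> (s \<otimes> u)) (s \<otimes> u \<otimes> (t \<otimes> u))"
      proof (rule loc_frac_eqI)
        show "(a \<otimes> t \<oplus> b \<otimes> s) \<otimes> c \<otimes> (s \<otimes> u \<otimes> (t \<otimes> u))
            = ((a \<otimes> c) \<otimes> (t \<otimes> u) \<oplus> (b \<otimes> c) \<otimes> (s \<otimes> u)) \<otimes> (s \<otimes> t \<otimes> u)"
          using k by algebra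
      qed (use f g h in \<open>auto simp: mult_in_iff\<close>)
      ultimately show ?thesis
        using p f g h
        by (simp add: mult_apply add_apply loc_mult_frac loc_add_frac mult_in_iff m_assoc)
    qed
    then show "(f \<otimes>\<^bsub>S\<^esub> g) \<otimes>\<^bsub>S\<^esub> h = f \<otimes>\<^bsub>S\<^esub> (g \<otimes>\<^bsub>S\<^esub> h)"
      "(f \<oplus>\<^bsub>S\<^esub> g) \<oplus>\<^bsub>S\<^esub> h = f \<oplus>\<^bsub>S\<^esub> (g \<oplus>\<^bsub>S\<^esub> h)"
      "(f \<oplus>\<^bsub>S\<^esub> g) \<otimes>\<^bsub>S\<^esub> h = f \<otimes>\<^bsub>S\<^esub> h \<oplus>\<^bsub>S\<^esub> g \<otimes>\<^bsub>S\<^esub> h"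
      by (auto intro!: section_eqI simp only: fgh closed)
  qed
  have zero_add: "\<iota> \<zero> \<oplus>\<^bsub>S\<^esub> f = f" if f: "f \<in> D" for f
  proof (rule section_eqI)
    fix p assume p: "p \<in> X"
    then interpret primeideal p R
      by (rule primeideal_X)
    obtain a s where "f p = loc_frac R p a s" "a \<in> carrier R" "s \<in> carrier R - p"
      using section_frac[OF f p] .
    then show "(\<iota> \<zero> \<oplus>\<^bsub>S\<^esub> f) p = f p"
      using p by (simp add: add_apply iota_apply loc_add_frac one_notin)
  qed (simp_all only: f closed zero_closed)
  have zero_mult: "\<iota> \<zero> \<otimes>\<^bsub>S\<^esub> f = \<iota> \<zero>" if f: "f \<in> D" for f
  proof (rule section_eqI)
    fix p assume p: "p \<in> X"
    then interpret primeideal p R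
      by (rule primeideal_X)
    obtain a s where "f p = loc_frac R p a s" "a \<in> carrier R" "s \<in> carrier R - p"
      using section_frac[OF f p] .
    then show "(\<iota> \<zero> \<otimes>\<^bsub>S\<^esub> f) p = \<iota> \<zero> p"
      using p loc_frac_eqI[of \<zero> \<zero> s \<one>]
      by (simp add: mult_apply iota_apply loc_mult_frac one_notin)
  qed (simp_all only: f closed zero_closed)
  \<comment> \<open>The negative of \<open>f\<close> is taken to be
    \<open>\<iota> (\<ominus> \<one>)\<close> times \<open>f\<close>, which lies in \<open>D\<close>
    because \<open>D\<close> contains the image of \<open>\<iota>\<close>.\<close>
  have add_inverse: "\<iota> (\<ominus> \<one>) \<otimes>\<^bsub>S\<^esub> f \<oplus>\<^bsub>S\<^esub> f = \<iota> \<zero>" if f: "f \<in> D" for f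
  proof -
    have "\<iota> (\<ominus> \<one>) \<otimes>\<^bsub>S\<^esub> f \<oplus>\<^bsub>S\<^esub> f = \<iota> (\<ominus> \<one>) \<otimes>\<^bsub>S\<^esub> f \<oplus>\<^bsub>S\<^esub> \<iota> \<one> \<otimes>\<^bsub>S\<^esub> f"
      using one_mult[OF f] by simp
    also have "\<dots> = (\<iota> (\<ominus> \<one>) \<oplus>\<^bsub>S\<^esub> \<iota> \<one>) \<otimes>\<^bsub>S\<^esub> f"
      using distr f iota_closed by simp
    also have "\<dots> = \<iota> \<zero>"
      using iota_add[of "\<ominus> \<one>" \<one>] zero_mult[OF f] by (simp add: l_neg)
    finally show ?thesis .
  qed
  show "abelian_group S"
  proof (rule abelian_groupI, unfold carrier_S zero_S)
    fix f assume "f \<in> D"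
    then show "\<exists>g\<in>D. g \<oplus>\<^bsub>S\<^esub> f = \<iota> \<zero>"
      using add_inverse closed by (intro bexI[of _ "\<iota> (\<ominus> \<one>) \<otimes>\<^bsub>S\<^esub> f"]) simp_all
  qed (fact zero_add add_assoc add_comm S_add_closed iota_closed[OF zero_closed])+
  show "comm_monoid S"
    by (rule comm_monoidI, unfold carrier_S one_S)
      (fact one_mult mult_assoc mult_comm S_mult_closed iota_closed[OF one_closed])+
  show "(f \<oplus>\<^bsub>S\<^esub> g) \<otimes>\<^bsub>S\<^esub> h = f \<otimes>\<^bsub>S\<^esub> h \<oplus>\<^bsub>S\<^esub> g \<otimes>\<^bsub>S\<^esub> h"
    if "f \<in> carrier S" "g \<in> carrier S" "h \<in> carrier S" for f g h
    using distr that by simp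
qed

end

subsection \<open>Differential primes of a ring of sections\<close>

context section_ring
begin

abbreviation \<Delta>' where "\<Delta>' \<equiv> sec_der R \<Delta> ` \<Delta>"

text \<open>The contraction to \<open>D\<close> of the maximal ideal of the localization at
  \<open>p\<close>, along evaluation at \<open>p\<close>. Some fraction for \<open>f p\<close> with
  numerator in \<open>p\<close> is asked for; \<open>vanish_iff\<close> shows that then every
  fraction for \<open>f p\<close> has this property.\<close>

definition vanish :: "'a set \<Rightarrow> ('a set \<Rightarrow> ('a \<times> 'a) set) set" where
  "vanish p = {f \<in> D. \<exists>a\<in>p. \<exists>s\<in>carrier R - p. f p = loc_frac R p a s}"

definition contract :: "('a set \<Rightarrow> ('a \<times> 'a) set) set \<Rightarrow> 'a set" where
  "contract q = {a \<in> carrier R. \<iota> a \<in> q}"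

lemma vanish_iff:
  assumes "f \<in> D" "p \<in> X" "f p = loc_frac R p a s" "a \<in> carrier R" "s \<in> carrier R - p"
  shows "f \<in> vanish p \<longleftrightarrow> a \<in> p"
proof -
  interpret primeideal p R
    using assms by (intro primeideal_X)
  show ?thesis
  proof
    assume "f \<in> vanish p"
    then obtain b t where b: "b \<in> p" "t \<in> carrier R - p" "f p = loc_frac R p b t"
      by (auto simp: vanish_def)
    then show "a \<in> p"
      using loc_frac_eq_imp_num_mem_iff[of a b s t] assms Icarr[OF b(1)] by simp
  qed (use assms in \<open>auto simp: vanish_def\<close>)
qed

lemma iota_vanish_iff:
  assumes "a \<in> carrier R" "p \<in> X"
  shows "\<iota> a \<in> vanish p \<longleftrightarrow> a \<in> p"
proof -
  interpret primeideal p R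
    using assms by (intro primeideal_X)
  show ?thesis
    using vanish_iff[of "\<iota> a" p a \<one>] assms one_notin by (simp add: iota_closed iota_apply)
qed

text \<open>In the quotient rule the numerator
  \<open>d a \<otimes> s \<ominus> a \<otimes> d s\<close> is in \<open>p\<close> together with
  \<open>a\<close> and \<open>d a\<close>, as \<open>p\<close> is a differential ideal.\<close>

lemma sec_der_vanish:
  assumes p: "p \<in> X" and d: "d \<in> \<Delta>" and f: "f \<in> vanish p"
  shows "sec_der R \<Delta> d f \<in> vanish p"
proof -
  interpret primeideal p R
    using p by (rule primeideal_X)
  obtain a s where a: "a \<in> p" "f p = loc_frac R p a s" and s: "s \<in> carrier R - p"
    and fD: "f \<in> D"
    using f by (auto simp: vanish_def)
  have da: "d a \<in> p"
    using p d a(1) by (rule dspecD)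
  have mem: "d a \<otimes> s \<ominus> a \<otimes> d s \<in> p"
    unfolding minus_eq using d da a(1) s by (intro a_closed a_inv_closed I_r_closed) simp_all
  moreover have "sec_der R \<Delta> d f p = loc_frac R p (d a \<otimes> s \<ominus> a \<otimes> d s) (s \<otimes> s)"
    using p d a s Icarr by (simp add: sec_der_def loc_der_frac[OF primeideal_X[OF p]])
  ultimately show ?thesis
    using vanish_iff[OF sec_der_closed[OF d fD] p, of "d a \<otimes> s \<ominus> a \<otimes> d s" "s \<otimes> s"] s Icarr[OF mem]
    by (simp add: mult_in_iff)
qed

text \<open>All conditions are read off from numerators at \<open>p\<close>: that of a product is
  \<open>a \<otimes> b\<close>, and \<open>p\<close> is prime.\<close>

lemma vanish_mem_dspec:
  assumes p: "p \<in> X"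
  shows "vanish p \<in> dspec S \<Delta>'"
proof -
  interpret primeideal p R
    using p by (rule primeideal_X)
  interpret S: cring S
    by (rule cring_S)
  have mult: "f \<otimes>\<^bsub>S\<^esub> g \<in> vanish p \<longleftrightarrow> f \<in> vanish p \<or> g \<in> vanish p"
    if fg: "f \<in> D" "g \<in> D" for f g
  proof -
    obtain a s where f: "f p = loc_frac R p a s" "a \<in> carrier R" "s \<in> carrier R - p"
      using section_frac[OF fg(1) p] .
    obtain b t where g: "g p = loc_frac R p b t" "b \<in> carrier R" "t \<in> carrier R - p"
      using section_frac[OF fg(2) p] .
    have "f \<otimes>\<^bsub>S\<^esub> g \<in> vanish p \<longleftrightarrow> a \<otimes> b \<in> p"
      using f g by (intro vanish_iff[OF S_mult_closed[OF fg] p, of _ "s \<otimes> t"])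
        (auto simp: mult_apply[OF p] loc_mult_frac mult_in_iff)
    then show ?thesis
      using vanish_iff[OF fg(1) p f] vanish_iff[OF fg(2) p g] f g by (simp add: mult_in_iff)
  qed
  have add: "f \<oplus>\<^bsub>S\<^esub> g \<in> vanish p" if fg: "f \<in> vanish p" "g \<in> vanish p" for f g
  proof -
    obtain a s where f: "f p = loc_frac R p a s" "a \<in> p" "s \<in> carrier R - p" "f \<in> D"
      using fg by (auto simp: vanish_def)
    obtain b t where g: "g p = loc_frac R p b t" "b \<in> p" "t \<in> carrier R - p" "g \<in> D"
      using fg by (auto simp: vanish_def)
    have ab: "a \<in> carrier R" "b \<in> carrier R"
      using f g Icarr by auto
    have "a \<otimes> t \<oplus> b \<otimes> s \<in> p"
      using f g by (intro a_closed I_r_closed) auto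
    then show ?thesis
      using f g ab by (subst vanish_iff[OF S_add_closed p, of _ _ "a \<otimes> t \<oplus> b \<otimes> s" "s \<otimes> t"])
        (auto simp: add_apply[OF p] loc_add_frac mult_in_iff)
  qed
  have "ideal (vanish p) S"
  proof (rule S.ideal_if_mult_closed)
    show "\<zero>\<^bsub>S\<^esub> \<in> vanish p"
      unfolding zero_S using iota_vanish_iff[of \<zero> p] p zero_closed Icarr by blast
    show "f \<otimes>\<^bsub>S\<^esub> g \<in> vanish p" if "f \<in> carrier S" "g \<in> vanish p" for f g
      using mult[of f g] that by (simp add: vanish_def)
    show "vanish p \<subseteq> carrier S"
      by (auto simp: vanish_def)
  qed (fact add)
  moreover have "\<one>\<^bsub>S\<^esub> \<notin> vanish p"
    unfolding one_S using iota_vanish_iff[OF one_closed p] one_notin by simp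
  ultimately have "primeideal (vanish p) S"
    using mult S.one_closed by (intro primeidealI cring_S) auto
  then show ?thesis
    using sec_der_vanish[OF p] by (auto simp: dspec_def)
qed

text \<open>Shows that \<open>vanish\<close> is a right inverse of \<open>contract\<close>, which
  gives surjectivity.\<close>

lemma contract_vanish:
  assumes "p \<in> X"
  shows "contract (vanish p) = p"
proof -
  interpret primeideal p R
    using assms by (rule primeideal_X)
  have "contract (vanish p) = {a \<in> carrier R. a \<in> p}"
    unfolding contract_def by (intro Collect_cong conj_cong refl iota_vanish_iff assms)
  also have "\<dots> = p"
    using a_subset by blast
  finally show ?thesis .
qed

text \<open>\<open>\<iota>\<close> is a ring homomorphism commuting with the derivations, so it
  pulls differential primes back to differential primes.\<close>

lemma contract_mem_dspec:
  assumes q: "q \<in> dspec S \<Delta>'"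
  shows "contract q \<in> X"
proof -
  interpret q: primeideal q S
    using q by (rule dspecD)
  have der: "d a \<in> contract q" if "d \<in> \<Delta>" "a \<in> contract q" for d a
    using that dspecD(2)[OF q, of "sec_der R \<Delta> d" "\<iota> a"] sec_der_iota
    by (auto simp: contract_def)
  have "ideal (contract q) R"
  proof (rule ideal_if_mult_closed)
    show "r \<otimes> x \<in> contract q" if "r \<in> carrier R" "x \<in> contract q" for r x
      using that q.I_l_closed by (simp add: contract_def iota_mult iota_closed)
    show "\<zero> \<in> contract q"
      using q.zero_closed by (simp add: contract_def zero_S[symmetric])
  qed (auto simp: contract_def iota_add)
  moreover have "\<one> \<notin> contract q"
    using q.one_notin by (simp add: contract_def one_S)
  ultimately have "primeideal (contract q) R"
    using q.I_prime one_closed is_cring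
    by (intro primeidealI) (auto simp: contract_def iota_mult iota_closed)
  then show ?thesis
    using der by (simp add: dspec_def)
qed

section \<open>Powers and zeros of sections at a point\<close>

lemma pow_apply:
  assumes f: "f p = loc_frac R p a s" "a \<in> carrier R" "s \<in> carrier R - p" and p: "p \<in> X"
  shows "(f [^]\<^bsub>S\<^esub> (n::nat)) p = loc_frac R p (a [^] n) (s [^] n)"
proof -
  interpret primeideal p R
    using p by (rule primeideal_X)
  show ?thesis
    using f p by (induction n) (simp_all add: one_S iota_apply mult_apply loc_mult_frac pow_notin)
qed

text \<open>The value of a product at \<open>p\<close> depends only on the values of the factors at
  \<open>p\<close>, so the factor that is zero there may be replaced by the zero section.\<close>

lemma mult_apply_eq_zero:
  assumes "f \<in> D" "g \<in> D" "p \<in> X" "f p = \<zero>\<^bsub>S\<^esub> p \<or> g p = \<zero>\<^bsub>S\<^esub> p"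
  shows "(f \<otimes>\<^bsub>S\<^esub> g) p = \<zero>\<^bsub>S\<^esub> p"
proof -
  interpret S: cring S
    by (rule cring_S)
  from assms(4) show ?thesis
  proof
    assume "f p = \<zero>\<^bsub>S\<^esub> p"
    then have "(f \<otimes>\<^bsub>S\<^esub> g) p = (\<zero>\<^bsub>S\<^esub> \<otimes>\<^bsub>S\<^esub> g) p"
      by (simp only: mult_apply[OF assms(3)])
    then show ?thesis
      using assms(2) by (simp add: S.l_null)
  next
    assume "g p = \<zero>\<^bsub>S\<^esub> p"
    then have "(f \<otimes>\<^bsub>S\<^esub> g) p = (f \<otimes>\<^bsub>S\<^esub> \<zero>\<^bsub>S\<^esub>) p"
      by (simp only: mult_apply[OF assms(3)])
    then show ?thesis
      using assms(1) by (simp add: S.r_null)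
  qed
qed

end

section \<open>The Keigher case: uniqueness of the prime over \<open>p\<close> and the
  homeomorphism\<close>

locale keigher_section_ring = section_ring + keigher_cring
begin

text \<open>The elements \<open>h\<close> such that a power of \<open>e\<close> is zero on \<open>D(h)\<close> form a differential ideal
  because \<open>D(h') \<subseteq> D(h)\<close>; this replaces a compactness argument.\<close>

lemma nilpotent_if_vanishes:
  assumes e: "e \<in> D" and vanishes: "\<And>p. p \<in> X \<Longrightarrow> e \<in> vanish p"
  shows "\<exists>n::nat. e [^]\<^bsub>S\<^esub> n = \<zero>\<^bsub>S\<^esub>"
proof -
  interpret S: cring S
    by (rule cring_S)
  have pow_closed: "e [^]\<^bsub>S\<^esub> n \<in> D" for n :: nat
    using S.nat_pow_closed[of e n] e by simp
  define I where "I = {h \<in> carrier R. \<exists>n::nat. \<forall>p\<in>X. h \<notin> p \<longrightarrow> (e [^]\<^bsub>S\<^esub> n) p = \<zero>\<^bsub>S\<^esub> p}"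
  \<comment> \<open>Membership in \<open>I\<close> passes from \<open>k\<close> to \<open>h\<close>
    whenever D(h) \<subseteq> D(k). This covers multiples, derivatives and square roots.\<close>
  have mono: "h \<in> I"
    if h: "h \<in> carrier R" and k: "k \<in> I" and le: "\<And>p. \<lbrakk>p \<in> X; h \<notin> p\<rbrakk> \<Longrightarrow> k \<notin> p" for h k
  proof -
    obtain n :: nat where "\<And>p. \<lbrakk>p \<in> X; k \<notin> p\<rbrakk> \<Longrightarrow> (e [^]\<^bsub>S\<^esub> n) p = \<zero>\<^bsub>S\<^esub> p"
      using k by (auto simp: I_def)
    then have "\<forall>p\<in>X. h \<notin> p \<longrightarrow> (e [^]\<^bsub>S\<^esub> n) p = \<zero>\<^bsub>S\<^esub> p"
      using le by blast
    then show ?thesis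
      using h unfolding I_def by blast
  qed
  have "semiprime_diff_ideal R \<Delta> I"
  proof (rule semiprime_diff_idealI)
    show "I \<subseteq> carrier R"
      by (auto simp: I_def)
    \<comment> \<open>Vacuous, since D(0) is empty.\<close>
    show "\<zero> \<in> I"
      using additive_subgroup.zero_closed[OF ideal.axioms(1)[OF primeideal.axioms(1)[OF primeideal_X]]]
      by (simp add: I_def)
    show "x \<oplus> y \<in> I" if xy: "x \<in> I" "y \<in> I" for x y
    proof -
      obtain m :: nat where m: "\<And>p. \<lbrakk>p \<in> X; x \<notin> p\<rbrakk> \<Longrightarrow> (e [^]\<^bsub>S\<^esub> m) p = \<zero>\<^bsub>S\<^esub> p"
        using xy(1) by (auto simp: I_def)
      obtain n :: nat where n: "\<And>p. \<lbrakk>p \<in> X; y \<notin> p\<rbrakk> \<Longrightarrow> (e [^]\<^bsub>S\<^esub> n) p = \<zero>\<^bsub>S\<^esub> p"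
        using xy(2) by (auto simp: I_def)
      \<comment> \<open>A prime missing \<open>x \<oplus> y\<close> misses \<open>x\<close> or
        \<open>y\<close>, so one of the factors, the \<open>m\<close>-th or the \<open>n\<close>-th
        power, is zero at it.\<close>
      have "(e [^]\<^bsub>S\<^esub> (m + n)) p = \<zero>\<^bsub>S\<^esub> p" if p: "p \<in> X" "x \<oplus> y \<notin> p" for p
      proof -
        have "x \<notin> p \<or> y \<notin> p"
          using p additive_subgroup.a_closed[OF ideal.axioms(1)[OF primeideal.axioms(1)[OF primeideal_X]]]
          by blast
        then have "(e [^]\<^bsub>S\<^esub> m \<otimes>\<^bsub>S\<^esub> e [^]\<^bsub>S\<^esub> n) p = \<zero>\<^bsub>S\<^esub> p"
          using m n p by (intro mult_apply_eq_zero pow_closed) blast+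
        then show ?thesis
          using e by (simp add: S.nat_pow_mult)
      qed
      then show ?thesis
        using xy by (auto simp: I_def)
    qed
    show "r \<otimes> x \<in> I" if "r \<in> carrier R" "x \<in> I" for r x
    proof (rule mono)
      show "r \<otimes> x \<in> carrier R"
        using that by (simp add: I_def)
      show "x \<notin> p" if "p \<in> X" "r \<otimes> x \<notin> p" for p
        using ideal.I_l_closed[OF primeideal.axioms(1)[OF primeideal_X[OF that(1)]]]
          \<open>r \<in> carrier R\<close> that(2) by metis
    qed fact
    show "d x \<in> I" if "d \<in> \<Delta>" "x \<in> I" for d x
    proof (rule mono)
      show "d x \<in> carrier R"
        using that by (simp add: I_def)
      show "x \<notin> p" if "p \<in> X" "d x \<notin> p" for p
        using dspecD(2)[OF that(1) \<open>d \<in> \<Delta>\<close>] that(2) by metis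
    qed fact
    show "x \<in> I" if "x \<in> carrier R" "x \<otimes> x \<in> I" for x
    proof (rule mono)
      show "x \<otimes> x \<notin> p" if "p \<in> X" "x \<notin> p" for p
        using primeideal.mult_in_iff[OF primeideal_X[OF that(1)]] that(2) \<open>x \<in> carrier R\<close> by simp
    qed fact+
  qed
  \<comment> \<open>Local nilpotency: every \<open>p\<close> has a neighbourhood D(h) on which some
    power of \<open>e\<close> is zero, so that \<open>h\<close> is in \<open>I\<close> but not in
    \<open>p\<close>.\<close>
  moreover have not_sub: "\<not> I \<subseteq> p" if p: "p \<in> X" for p
  proof -
    obtain h a b where h: "h \<in> carrier R - p" and ab: "a \<in> carrier R" "b \<in> carrier R"
      and frac: "\<And>q. \<lbrakk>q \<in> X; h \<notin> q\<rbrakk> \<Longrightarrow> b \<notin> q \<and> e q = loc_frac R q a b"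
      using section_locally_frac[OF e p] by metis
    \<comment> \<open>On D(h) the value \<open>a / b\<close> lies in the maximal ideal, hence
      \<open>a \<in> q\<close>; off D(h) one has \<open>h \<in> q\<close>. So
      \<open>a \<otimes> h\<close> lies in every differential prime and is nilpotent.\<close>
    have "a \<otimes> h \<in> q" if q: "q \<in> X" for q
    proof -
      interpret primeideal q R
        using q by (rule primeideal_X)
      show ?thesis
        using vanish_iff[OF e q, of a b] frac[OF q] vanishes[OF q] ab h
        by (auto simp: mult_in_iff)
    qed
    then obtain n :: nat where n: "(a \<otimes> h) [^] n = \<zero>"
      using nilpotent_if_in_all_diff_primes ab h by (meson DiffD1 m_closed)
    have "(e [^]\<^bsub>S\<^esub> n) q = \<zero>\<^bsub>S\<^esub> q" if q: "q \<in> X" "h \<notin> q" for q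
    proof -
      interpret primeideal q R
        using q by (intro primeideal_X)
      \<comment> \<open>For \<open>q\<close> in D(h) the power of \<open>h\<close> is outside
        \<open>q\<close>, so it witnesses that the \<open>n\<close>-th power of \<open>a / b\<close>
        is zero.\<close>
      have "h [^] n \<otimes> a [^] n = \<zero>"
        using n ab h by (simp add: nat_pow_distrib m_comm)
      moreover have "h [^] n \<in> carrier R - q"
        using pow_notin q h by simp
      ultimately have "loc_frac R q (a [^] n) (b [^] n) = loc_frac R q \<zero> \<one>"
        using frac[OF q] pow_notin ab by (subst loc_frac_eq_zero_iff) auto
      then show ?thesis
        using pow_apply[of e q a b n] frac[OF q] ab q by (simp add: zero_S iota_apply)
    qed
    then have "h \<in> I"
      using h by (auto simp: I_def)
    then show ?thesis
      using h by blast
  qed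
  \<comment> \<open>If \<open>I\<close> missed the unit, some differential prime would contain
    \<open>I\<close>.\<close>
  ultimately have "\<one> \<in> I"
    by (metis exists_diff_prime_avoiding one_closed)
  then obtain n :: nat where n: "\<And>p. \<lbrakk>p \<in> X; \<one> \<notin> p\<rbrakk> \<Longrightarrow> (e [^]\<^bsub>S\<^esub> n) p = \<zero>\<^bsub>S\<^esub> p"
    by (auto simp: I_def)
  have "e [^]\<^bsub>S\<^esub> n = \<zero>\<^bsub>S\<^esub>"
    using n primeideal.one_notin[OF primeideal_X] pow_closed S.zero_closed
    by (intro section_eqI) auto
  then show ?thesis ..
qed

text \<open>Such an \<open>e\<close> is nilpotent, and a prime ideal contains every nilpotent
  element.\<close>

lemma mem_diff_prime_if_vanishes:
  assumes q: "q \<in> dspec S \<Delta>'" and e: "e \<in> D" "\<And>p. p \<in> X \<Longrightarrow> e \<in> vanish p"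
  shows "e \<in> q"
proof -
  interpret q: primeideal q S
    using q by (rule dspecD)
  obtain n :: nat where "e [^]\<^bsub>S\<^esub> n = \<zero>\<^bsub>S\<^esub>"
    using nilpotent_if_vanishes[OF e] by blast
  then show ?thesis
    using q.pow_notin[of e n] q.zero_closed e by auto
qed

text \<open>Gives injectivity: a differential prime of \<open>D\<close> is recovered from its
  contraction. Each \<open>f\<close> is compared with \<open>a\<close> through the local identity
  \<open>b f = a\<close>, which survives in \<open>q\<close> after multiplication by
  \<open>h\<close>.\<close>

lemma vanish_contract:
  assumes q: "q \<in> dspec S \<Delta>'"
  shows "vanish (contract q) = q"
proof -
  interpret q: primeideal q S
    using q by (rule dspecD)
  define p where "p = contract q"
  have p: "p \<in> X"
    unfolding p_def using q by (rule contract_mem_dspec)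
  have iota_q: "\<iota> c \<in> q \<longleftrightarrow> c \<in> p" if "c \<in> carrier R" for c
    using that by (simp add: p_def contract_def)
  have "f \<in> vanish p \<longleftrightarrow> f \<in> q" if f: "f \<in> D" for f
  proof -
    obtain h a b where h: "h \<in> carrier R - p" and ab: "a \<in> carrier R" "b \<in> carrier R"
      and frac: "\<And>x. \<lbrakk>x \<in> X; h \<notin> x\<rbrakk> \<Longrightarrow> b \<notin> x \<and> f x = loc_frac R x a b"
      using section_locally_frac[OF f p] by metis
    note D = f iota_closed[OF ab(1)] iota_closed[OF ab(2)] iota_closed[of h]
    have hR: "h \<in> carrier R"
      using h by simp
    define g where "g = \<iota> b \<otimes>\<^bsub>S\<^esub> f \<ominus>\<^bsub>S\<^esub> \<iota> a"
    have g: "g \<in> D"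
      unfolding g_def using D q.minus_closed[of "\<iota> b \<otimes>\<^bsub>S\<^esub> f" "\<iota> a"] S_mult_closed by simp
    \<comment> \<open>On D(h) the factor \<open>g\<close> is zero because \<open>f = a / b\<close>
      there; off D(h) the factor \<open>\<iota> h\<close> has numerator in \<open>x\<close>.\<close>
    have "\<iota> h \<otimes>\<^bsub>S\<^esub> g \<in> vanish x" if x: "x \<in> X" for x
    proof -
      interpret x: primeideal x R
        using x by (rule primeideal_X)
      interpret v: primeideal "vanish x" S
        using vanish_mem_dspec[OF x] by (rule dspecD)
      have "g \<in> vanish x" if hx: "h \<notin> x"
      proof -
        have b: "b \<notin> x" "f x = loc_frac R x a b"
          using frac[OF x hx] by auto
        have "(\<iota> b \<otimes>\<^bsub>S\<^esub> f) x = \<iota> a x"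
          using b ab x x.one_notin x.loc_frac_eqI[of "b \<otimes> a" a b \<one>]
          by (simp add: mult_apply iota_apply x.loc_mult_frac m_comm)
        then have "g x = (\<iota> a \<ominus>\<^bsub>S\<^esub> \<iota> a) x"
          by (simp add: g_def a_minus_def add_apply[OF x])
        also have "\<dots> = \<iota> \<zero> x"
          using D q.r_neg[of "\<iota> a"] by (simp add: a_minus_def zero_S)
        finally show ?thesis
          using vanish_iff[OF g x, of \<zero> \<one>] x x.one_notin x.zero_closed
          by (simp add: iota_apply)
      qed
      then show ?thesis
        using iota_vanish_iff[OF hR x] v.I_l_closed v.I_r_closed g D(4)[OF hR] by fastforce
    qed
    then have "\<iota> h \<otimes>\<^bsub>S\<^esub> g \<in> q"
      \<comment> \<open>The Keigher property enters here: vanishing at all points of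
        \<open>X\<close> implies membership in \<open>q\<close>.\<close>
      using mem_diff_prime_if_vanishes[OF q] S_mult_closed D(4)[OF hR] g by blast
    then have gq: "g \<in> q"
      using q.mult_in_iff[of "\<iota> h" g] D(4)[OF hR] g iota_q[OF hR] h by simp
    \<comment> \<open>\<open>p\<close> itself is in D(h), so \<open>b \<notin> p\<close> and hence
      \<open>\<iota> b \<notin> q\<close>; primality cancels it.\<close>
    have "f \<in> q \<longleftrightarrow> \<iota> b \<otimes>\<^bsub>S\<^esub> f \<in> q"
      using q.mult_in_iff[of "\<iota> b" f] D iota_q[OF ab(2)] frac[OF p] h by simp
    also have "\<dots> \<longleftrightarrow> \<iota> a \<in> q"
      using q.mem_iff_if_minus_mem[of "\<iota> b \<otimes>\<^bsub>S\<^esub> f" "\<iota> a"] gq D S_mult_closed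
      by (simp add: g_def)
    also have "\<dots> \<longleftrightarrow> f \<in> vanish p"
      using iota_q[OF ab(1)] vanish_iff[OF f p, of a b] frac[OF p] h ab by simp
    finally show ?thesis ..
  qed
  moreover have "q \<subseteq> D" "vanish p \<subseteq> D"
    using q.Icarr by (auto simp: vanish_def)
  ultimately show ?thesis
    unfolding p_def by blast
qed

text \<open>Continuity holds because the preimage of D(h) is the basic open set of
  \<open>\<iota> h\<close>. Openness uses that \<open>f = a / b\<close> on some D(h): the image of
  the basic open set of \<open>f\<close> then contains D(a h).\<close>

lemma homeomorphic_map_contract:
  "homeomorphic_map (kolchin_topology S \<Delta>') (kolchin_topology R \<Delta>) contract"
proof (rule bijective_open_imp_homeomorphic_map)
  show "continuous_map (kolchin_topology S \<Delta>') (kolchin_topology R \<Delta>) contract"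
    unfolding continuous_map_def topspace_kolchin openin_kolchin
  proof (intro conjI allI impI)
    show "contract \<in> dspec S \<Delta>' \<rightarrow> X"
      using contract_mem_dspec by blast
    fix W assume W: "kolchin_open R \<Delta> W"
    show "kolchin_open S \<Delta>' {q \<in> dspec S \<Delta>'. contract q \<in> W}"
      unfolding kolchin_open_iff
    proof (intro conjI ballI)
      fix q assume q: "q \<in> {q \<in> dspec S \<Delta>'. contract q \<in> W}"
      then have "\<exists>h\<in>carrier R - contract q. \<forall>p\<in>X. h \<notin> p \<longrightarrow> p \<in> W"
        using W by (simp add: kolchin_open_iff)
      then obtain h where h: "h \<in> carrier R" "h \<notin> contract q"
        "\<And>p. \<lbrakk>p \<in> X; h \<notin> p\<rbrakk> \<Longrightarrow> p \<in> W"
        by auto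
      then have "\<iota> h \<in> carrier S - q"
        by (simp add: contract_def iota_closed)
      moreover have "x \<in> {q \<in> dspec S \<Delta>'. contract q \<in> W}"
        if "x \<in> dspec S \<Delta>'" "\<iota> h \<notin> x" for x
        using that h(3)[OF contract_mem_dspec[OF that(1)]] by (simp add: contract_def)
      ultimately show "\<exists>k\<in>carrier S - q. \<forall>x\<in>dspec S \<Delta>'.
          k \<notin> x \<longrightarrow> x \<in> {q \<in> dspec S \<Delta>'. contract q \<in> W}"
        by blast
    qed blast
  qed
  show "open_map (kolchin_topology S \<Delta>') (kolchin_topology R \<Delta>) contract"
    unfolding open_map_def openin_kolchin
  proof (intro allI impI)
    fix U assume U: "kolchin_open S \<Delta>' U"
    show "kolchin_open R \<Delta> (contract ` U)"
      unfolding kolchin_open_iff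
    proof (intro conjI ballI)
      show "contract ` U \<subseteq> X"
        using U contract_mem_dspec by (auto simp: kolchin_open_iff)
      fix p assume "p \<in> contract ` U"
      then obtain q where q: "q \<in> U" "p = contract q"
        by blast
      then have qS: "q \<in> dspec S \<Delta>'"
        using U by (auto simp: kolchin_open_iff)
      then have p: "p \<in> X"
        using q contract_mem_dspec by simp
      have "\<exists>f\<in>carrier S - q. \<forall>x\<in>dspec S \<Delta>'. f \<notin> x \<longrightarrow> x \<in> U"
        using U q(1) by (simp only: kolchin_open_iff)
      then obtain f where f: "f \<in> D" "f \<notin> q" "\<And>x. \<lbrakk>x \<in> dspec S \<Delta>'; f \<notin> x\<rbrakk> \<Longrightarrow> x \<in> U"
        by auto
      obtain h a b where h: "h \<in> carrier R - p" and ab: "a \<in> carrier R" "b \<in> carrier R"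
        and frac: "\<And>x. \<lbrakk>x \<in> X; h \<notin> x\<rbrakk> \<Longrightarrow> b \<notin> x \<and> f x = loc_frac R x a b"
        using section_locally_frac[OF f(1) p] by metis
      have van: "f \<in> vanish x \<longleftrightarrow> a \<in> x" if "x \<in> X" "h \<notin> x" for x
        using vanish_iff[OF f(1) that(1), of a b] frac[OF that] ab by simp
      have "a \<otimes> h \<in> carrier R - p"
        \<comment> \<open>Since \<open>q = vanish p\<close>, the assumption
          \<open>f \<notin> q\<close> says that the local numerator \<open>a\<close> is not in
          \<open>p\<close>.\<close>
        using van[OF p] f(2) vanish_contract[OF qS] q(2) h ab
          primeideal.mult_in_iff[OF primeideal_X[OF p]] by simp
      moreover have "x \<in> contract ` U" if x: "x \<in> X" "a \<otimes> h \<notin> x" for x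
      proof -
        have "a \<notin> x" "h \<notin> x"
          using x ab h primeideal.mult_in_iff[OF primeideal_X[OF x(1)]] by auto
        \<comment> \<open>\<open>vanish x\<close> is the preimage of \<open>x\<close> under
          \<open>contract\<close>, and it misses \<open>f\<close> because
          \<open>a \<notin> x\<close>.\<close>
        then have "vanish x \<in> U"
          using van x f(3)[OF vanish_mem_dspec[OF x(1)]] by simp
        then show ?thesis
          using contract_vanish[OF x(1)] by force
      qed
      ultimately show "\<exists>k\<in>carrier R - p. \<forall>x\<in>X. k \<notin> x \<longrightarrow> x \<in> contract ` U"
        by blast
    qed
  qed
  show "contract ` topspace (kolchin_topology S \<Delta>') = topspace (kolchin_topology R \<Delta>)"
    unfolding topspace_kolchin
    using contract_mem_dspec vanish_mem_dspec contract_vanish by (auto simp: image_iff) metis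
  show "inj_on contract (topspace (kolchin_topology S \<Delta>'))"
    unfolding topspace_kolchin by (rule inj_on_inverseI) (rule vanish_contract)
qed

end

theorem theorem3p2:
  fixes R :: "('a, 'm) ring_scheme" and \<Delta> :: "('a \<Rightarrow> 'a) set"
    and D :: "('a set \<Rightarrow> ('a \<times> 'a) set) set"
  assumes keigher: "keigher_ring R \<Delta>"
    and D_subring: "subring D (sections_ring R \<Delta>)"
    and D_diff: "\<forall>d\<in>\<Delta>. \<forall>f\<in>D. sec_der R \<Delta> d f \<in> D"
    and D_iota: "loc_iota R \<Delta> ` carrier R \<subseteq> D"
  shows "homeomorphic_map
           (kolchin_topology ((sections_ring R \<Delta>)\<lparr>carrier := D\<rparr>) (sec_der R \<Delta> ` \<Delta>))
           (kolchin_topology R \<Delta>)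
           (\<lambda>q. {a \<in> carrier R. loc_iota R \<Delta> a \<in> q})"
proof -
  interpret keigher_cring R \<Delta>
    using keigher by (rule keigher_ring_imp_keigher_cring)
  interpret keigher_section_ring R \<Delta> D
  proof (intro keigher_section_ring.intro section_ring.intro section_ring_axioms.intro
      diff_cring_axioms keigher_cring_axioms)
    show "subring D (sections_ring R \<Delta>)"
      by (fact D_subring)
    show "loc_iota R \<Delta> a \<in> D" if "a \<in> carrier R" for a
      using D_iota that by (rule subsetD[OF _ imageI])
    show "sec_der R \<Delta> d f \<in> D" if "d \<in> \<Delta>" "f \<in> D" for d f
      using D_diff that by (metis (no_types))
  qed
  show ?thesis
    using homeomorphic_map_contract unfolding S_def contract_def .
qed

end
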